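(* Let $A\in\mathbb{C}^{2\times2}$ be non-singular and let $\alpha\le\beta$ be real with $\beta-\alpha<\pi$. If there exists a non-singular diagonal matrix $B\in\mathbb{C}^{2\times2}$ such that $$\mathrm{Num}(B^{-1}AB)\subset S(\alpha,\beta),$$ then $\mathrm{Spec}(AD)\subset S(\alpha,\beta)$, and for any small enough $\varepsilon>0$ there exists $k_\varepsilon>0$ independent of $z$ such that $$\|(AD-z)^{-1}\|\le\frac{k_\varepsilon}{|z|}\qquad\text{for all } z\notin S(\alpha-\varepsilon,\beta+\varepsilon).$$
   Context: Let $W^{2,2}$ be the Sobolev space of all $f\in L^2(0,1)\otimes\mathbb{C}^2$ whose generalized derivative $f''$ lies in $L^2(0,1)\otimes\mathbb{C}^2$, and write $f=\begin{pmatrix}\phi\\ \gamma\end{pmatrix}$. The operator $D$ acts on $L^2(0,1)\otimes\mathbb{C}^2$ by $Df=-f''$ with domain $\mathrm{Dom}(D)=\{f\in W^{2,2}:\phi(0)=\phi(1)=0,\ \gamma'(0)=\gamma'(1)=0\}$. $AD$ is the operator $f\mapsto -Af''$ with domain $\mathrm{Dom}(D)$. $\mathrm{Spec}$ denotes the spectrum and, for a matrix $C$, $\mathrm{Num}(C)=\{\langle Cv,v\rangle:v\in\mathbb{C}^2,\ |v|=1\}$. For real $\alpha\le\beta$, $S(\alpha,\beta)=\{z\in\mathbb{C}:\alpha\le\arg z\le\beta\}$, where $\arg z$ may be any determination of the argument (it is taken modulo $2\pi$) and $0$ is counted as an element of $S(\alpha,\beta)$. *)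

theory Defs
  imports "HOL-Analysis.Analysis"
begin

abbreviation unit_measure :: "real measure"
  where "unit_measure \<equiv> lebesgue_on {0<..<1}"

definition square_integrable :: "(real \<Rightarrow> complex^2) \<Rightarrow> bool"
  where "square_integrable f \<longleftrightarrow>
    f \<in> borel_measurable unit_measure \<and> integrable unit_measure (\<lambda>x. (norm (f x))\<^sup>2)"

definition ae_eq :: "(real \<Rightarrow> complex^2) \<Rightarrow> (real \<Rightarrow> complex^2) \<Rightarrow> bool"
  where "ae_eq f g \<longleftrightarrow>
    square_integrable f \<and> square_integrable g \<and> (AE x in unit_measure. f x = g x)"

lemma square_integrable_zero [simp]: "square_integrable (\<lambda>x. 0)"
  by (simp add: square_integrable_def)

lemma square_integrable_bound:
  assumes "square_integrable f" "square_integrable g" "h \<in> borel_measurable unit_measure"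
    and "\<And>x. (norm (h x))\<^sup>2 \<le> c * (norm (f x))\<^sup>2 + d * (norm (g x))\<^sup>2"
  shows "square_integrable h"
  unfolding square_integrable_def
proof
  show "integrable unit_measure (\<lambda>x. (norm (h x))\<^sup>2)"
  proof (rule Bochner_Integration.integrable_bound)
    show "integrable unit_measure (\<lambda>x. c * (norm (f x))\<^sup>2 + d * (norm (g x))\<^sup>2)"
      using assms by (simp add: square_integrable_def)
    show "(\<lambda>x. (norm (h x))\<^sup>2) \<in> borel_measurable unit_measure"
      using assms(3) by measurable
    show "AE x in unit_measure. norm ((norm (h x))\<^sup>2)
        \<le> norm (c * (norm (f x))\<^sup>2 + d * (norm (g x))\<^sup>2)"
      using assms(4) by (intro AE_I2) (simp add: order.trans[OF _ abs_ge_self])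
  qed
qed (fact assms(3))

lemma norm_add_sq_le: "(norm (a + b))\<^sup>2 \<le> 2 * (norm a)\<^sup>2 + 2 * (norm b)\<^sup>2"
  for a b :: "'a::real_inner"
proof -
  have "0 \<le> (norm (a - b))\<^sup>2" by simp
  then show ?thesis
    by (simp add: power2_norm_eq_inner inner_add_left inner_add_right inner_diff_left
        inner_diff_right inner_commute)
qed

lemma square_integrable_add:
  assumes "square_integrable f" "square_integrable g"
  shows "square_integrable (\<lambda>x. f x + g x)"
  using assms norm_add_sq_le
  by (intro square_integrable_bound[OF assms, where c = 2 and d = 2])
    (auto simp: square_integrable_def)

lemma bounded_linear_square_integrable:
  assumes L: "bounded_linear L" and f: "square_integrable f"
  shows "square_integrable (\<lambda>x. L (f x))"
proof -
  obtain K where K: "\<And>v. norm (L v) \<le> norm v * K" and "K > 0"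
    using bounded_linear.pos_bounded[OF L] by blast
  show ?thesis
  proof (rule square_integrable_bound[OF f f, where c = "K\<^sup>2" and d = 0])
    show "(\<lambda>x. L (f x)) \<in> borel_measurable unit_measure"
      using f L by (auto simp: square_integrable_def
          intro: measurable_compose[OF _ borel_measurable_continuous_onI]
            linear_continuous_on bounded_linear.linear)
    fix x
    have "(norm (L (f x)))\<^sup>2 \<le> (norm (f x) * K)\<^sup>2"
      using K by (intro power_mono) auto
    then show "(norm (L (f x)))\<^sup>2 \<le> K\<^sup>2 * (norm (f x))\<^sup>2 + 0 * (norm (f x))\<^sup>2"
      by (simp add: power_mult_distrib mult.commute)
  qed
qed

lemma square_integrable_scaleR:
  "square_integrable f \<Longrightarrow> square_integrable (\<lambda>x. r *\<^sub>R f x)"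
  by (rule bounded_linear_square_integrable[OF bounded_linear_scaleR_right])

lemma square_integrable_minus:
  "square_integrable f \<Longrightarrow> square_integrable (\<lambda>x. - f x)"
  using bounded_linear_square_integrable[OF bounded_linear_minus[OF bounded_linear_ident]] by simp

lemma square_integrable_diff:
  "square_integrable f \<Longrightarrow> square_integrable g \<Longrightarrow> square_integrable (\<lambda>x. f x - g x)"
  using square_integrable_add[OF _ square_integrable_minus, of f g] by simp

lemma bounded_linear_matrix_vector_complex: "bounded_linear ((*v) (C :: complex^2^2))"
  by (rule linear_conv_bounded_linear[THEN iffD1], rule linearI)
     (simp_all add: vec_eq_iff matrix_vector_mult_def sum.distrib scaleR_sum_right
        distrib_left)

lemma square_integrable_matrix:
  "square_integrable f \<Longrightarrow> square_integrable (\<lambda>x. (C :: complex^2^2) *v f x)"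
  by (rule bounded_linear_square_integrable[OF bounded_linear_matrix_vector_complex])

lemma bounded_linear_vector_scalar_complex: "bounded_linear (\<lambda>v :: complex^2. c *s v)"
  by (rule linear_conv_bounded_linear[THEN iffD1], rule linearI)
     (simp_all add: vec_eq_iff distrib_left)

lemma square_integrable_scaleC:
  "square_integrable f \<Longrightarrow> square_integrable (\<lambda>x. c *s f x)"
  by (rule bounded_linear_square_integrable[OF bounded_linear_vector_scalar_complex])

lemma integrable_inner_square_integrable:
  assumes "square_integrable f" "square_integrable g"
  shows "integrable unit_measure (\<lambda>x. f x \<bullet> g x)"
proof (rule Bochner_Integration.integrable_bound)
  show "integrable unit_measure (\<lambda>x. (norm (f x))\<^sup>2 + (norm (g x))\<^sup>2)"
    using assms by (simp add: square_integrable_def)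
  have [measurable]: "f \<in> borel_measurable unit_measure" "g \<in> borel_measurable unit_measure"
    using assms by (auto simp: square_integrable_def)
  show "(\<lambda>x. f x \<bullet> g x) \<in> borel_measurable unit_measure"
    by measurable
  have "\<bar>f x \<bullet> g x\<bar> \<le> (norm (f x))\<^sup>2 + (norm (g x))\<^sup>2" for x
  proof -
    have "\<bar>f x \<bullet> g x\<bar> \<le> norm (f x) * norm (g x)" by (rule Cauchy_Schwarz_ineq2)
    moreover have "2 * (norm (f x) * norm (g x)) \<le> (norm (f x))\<^sup>2 + (norm (g x))\<^sup>2"
      using sum_squares_bound[of "norm (f x)" "norm (g x)"] by (simp add: mult.assoc)
    moreover have "0 \<le> norm (f x) * norm (g x)" by simp
    ultimately show ?thesis by linarith
  qed
  then show "AE x in unit_measure. norm (f x \<bullet> g x) \<le> norm ((norm (f x))\<^sup>2 + (norm (g x))\<^sup>2)"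
    by (intro AE_I2) simp
qed

quotient_type L2 = "real \<Rightarrow> complex^2" / partial: ae_eq
  morphisms rep_L2 abs_L2
proof (rule part_equivpI)
  show "\<exists>f. ae_eq f f"
    by (rule exI[of _ "\<lambda>x. 0"]) (simp add: ae_eq_def)
  show "symp ae_eq"
    by (rule sympI) (auto simp: ae_eq_def elim: eventually_mono)
  show "transp ae_eq"
    by (rule transpI) (auto simp: ae_eq_def elim: eventually_elim2)
qed

lemma ae_eqD_measurable:
  "ae_eq f g \<Longrightarrow> f \<in> borel_measurable unit_measure"
  "ae_eq f g \<Longrightarrow> g \<in> borel_measurable unit_measure"
  by (auto simp: ae_eq_def square_integrable_def)

instantiation L2 :: real_inner
begin

lift_definition zero_L2 :: L2 is "\<lambda>x. 0"
  by (simp add: ae_eq_def)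

lift_definition plus_L2 :: "L2 \<Rightarrow> L2 \<Rightarrow> L2" is "\<lambda>f g x. f x + g x"
  by (auto simp: ae_eq_def intro: square_integrable_add elim: eventually_elim2)

lift_definition minus_L2 :: "L2 \<Rightarrow> L2 \<Rightarrow> L2" is "\<lambda>f g x. f x - g x"
  by (auto simp: ae_eq_def intro: square_integrable_diff elim: eventually_elim2)

lift_definition uminus_L2 :: "L2 \<Rightarrow> L2" is "\<lambda>f x. - f x"
  by (auto simp: ae_eq_def intro: square_integrable_minus elim: eventually_mono)

lift_definition scaleR_L2 :: "real \<Rightarrow> L2 \<Rightarrow> L2" is "\<lambda>r f x. r *\<^sub>R f x"
  by (auto simp: ae_eq_def intro: square_integrable_scaleR elim: eventually_mono)

(* The real inner product, i.e. the real part of the complex one; only the norm that it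
   induces is used below. *)
lift_definition inner_L2 :: "L2 \<Rightarrow> L2 \<Rightarrow> real" is "\<lambda>f g. LINT x|unit_measure. f x \<bullet> g x"
proof -
  fix f f' g g' :: "real \<Rightarrow> complex^2"
  assume *: "ae_eq f f'" "ae_eq g g'"
  have [measurable]: "f \<in> borel_measurable unit_measure" "f' \<in> borel_measurable unit_measure"
    "g \<in> borel_measurable unit_measure" "g' \<in> borel_measurable unit_measure"
    using * by (auto dest: ae_eqD_measurable)
  show "(LINT x|unit_measure. f x \<bullet> g x) = (LINT x|unit_measure. f' x \<bullet> g' x)"
    by (rule integral_cong_AE) (use * in \<open>auto simp: ae_eq_def elim: eventually_elim2\<close>)
qed

lift_definition norm_L2 :: "L2 \<Rightarrow> real" is "\<lambda>f. sqrt (LINT x|unit_measure. (norm (f x))\<^sup>2)"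
proof -
  fix f f' :: "real \<Rightarrow> complex^2"
  assume *: "ae_eq f f'"
  have [measurable]: "f \<in> borel_measurable unit_measure" "f' \<in> borel_measurable unit_measure"
    using * by (auto dest: ae_eqD_measurable)
  have "(LINT x|unit_measure. (norm (f x))\<^sup>2) = (LINT x|unit_measure. (norm (f' x))\<^sup>2)"
    by (rule integral_cong_AE) (use * in \<open>auto simp: ae_eq_def elim: eventually_mono\<close>)
  then show "sqrt (LINT x|unit_measure. (norm (f x))\<^sup>2) = sqrt (LINT x|unit_measure. (norm (f' x))\<^sup>2)"
    by simp
qed

definition dist_L2 :: "L2 \<Rightarrow> L2 \<Rightarrow> real"
  where "dist_L2 f g = norm (f - g)"

definition sgn_L2 :: "L2 \<Rightarrow> L2"
  where "sgn_L2 f = inverse (norm f) *\<^sub>R f"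

definition uniformity_L2 :: "(L2 \<times> L2) filter"
  where "uniformity_L2 = (INF e\<in>{0<..}. principal {(f, g). dist f g < e})"

definition open_L2 :: "L2 set \<Rightarrow> bool"
  where "open_L2 U = (\<forall>f\<in>U. eventually (\<lambda>(f', g). f' = f \<longrightarrow> g \<in> U) uniformity)"

instance
proof
  fix f g h :: L2 and r s :: real
  show "f + g + h = f + (g + h)"
    by transfer (auto simp: ae_eq_def add.assoc intro!: square_integrable_add)
  show "f + g = g + f"
    by transfer (auto simp: ae_eq_def add.commute intro!: square_integrable_add)
  show "0 + f = f"
    by transfer (auto simp: ae_eq_def)
  show "- f + f = 0"
    by transfer (auto simp: ae_eq_def)
  show "f - g = f + - g"
    by transfer (auto simp: ae_eq_def intro!: square_integrable_diff)
  show "r *\<^sub>R (f + g) = r *\<^sub>R f + r *\<^sub>R g"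
    by transfer (auto simp: ae_eq_def scaleR_add_right
        intro!: square_integrable_add square_integrable_scaleR)
  show "(r + s) *\<^sub>R f = r *\<^sub>R f + s *\<^sub>R f"
    by transfer (auto simp: ae_eq_def scaleR_add_left
        intro!: square_integrable_add square_integrable_scaleR)
  show "r *\<^sub>R s *\<^sub>R f = (r * s) *\<^sub>R f"
    by transfer (auto simp: ae_eq_def intro!: square_integrable_scaleR)
  show "1 *\<^sub>R f = f"
    by transfer (auto simp: ae_eq_def)
  show "dist f g = norm (f - g)" by (rule dist_L2_def)
  show "sgn f = inverse (norm f) *\<^sub>R f" by (rule sgn_L2_def)
  show "uniformity = (INF e\<in>{0<..}. principal {(f :: L2, g). dist f g < e})"
    by (rule uniformity_L2_def)
  show "open U \<longleftrightarrow> (\<forall>f\<in>U. \<forall>\<^sub>F (f', g) in uniformity. f' = f \<longrightarrow> g \<in> U)" for U :: "L2 set"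
    by (rule open_L2_def)
  show "f \<bullet> g = g \<bullet> f"
    by transfer (simp add: inner_commute)
  show "(f + g) \<bullet> h = f \<bullet> h + g \<bullet> h"
    by transfer (simp add: ae_eq_def inner_add_left integrable_inner_square_integrable)
  show "(r *\<^sub>R f) \<bullet> g = r * (f \<bullet> g)"
    by transfer simp
  show "0 \<le> f \<bullet> f"
    by transfer simp
  show "f \<bullet> f = 0 \<longleftrightarrow> f = 0"
  proof transfer
    fix f :: "real \<Rightarrow> complex^2"
    assume "ae_eq f f"
    then have f: "square_integrable f" by (simp add: ae_eq_def)
    show "(LINT x|unit_measure. f x \<bullet> f x) = 0 \<longleftrightarrow> ae_eq f (\<lambda>x. 0)"
      using f integral_nonneg_eq_0_iff_AE[OF integrable_inner_square_integrable[OF f f]]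
      by (simp add: ae_eq_def)
  qed
  show "norm f = sqrt (f \<bullet> f)"
    by transfer (simp add: power2_norm_eq_inner)
qed

end

lift_definition scaleC_L2 :: "complex \<Rightarrow> L2 \<Rightarrow> L2" (infixr \<open>*\<^sub>C\<close> 75) is "\<lambda>c f x. c *s f x"
  by (auto simp: ae_eq_def intro: square_integrable_scaleC elim: eventually_mono)

lift_definition matrix_L2 :: "complex^2^2 \<Rightarrow> L2 \<Rightarrow> L2" is "\<lambda>C f x. C *v f x"
  by (auto simp: ae_eq_def intro: square_integrable_matrix elim: eventually_mono)

definition test_function :: "(real \<Rightarrow> real) \<Rightarrow> bool"
  where "test_function \<psi> \<longleftrightarrow>
    (\<forall>n. (deriv ^^ n) \<psi> differentiable_on UNIV) \<and>
    (\<exists>K. compact K \<and> K \<subseteq> {0<..<1} \<and> (\<forall>x. x \<notin> K \<longrightarrow> \<psi> x = 0))"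

definition weak_deriv2 :: "L2 \<Rightarrow> L2 \<Rightarrow> bool"
  where "weak_deriv2 f g \<longleftrightarrow> (\<forall>\<psi>. test_function \<psi> \<longrightarrow>
    (LINT x|unit_measure. deriv (deriv \<psi>) x *\<^sub>R rep_L2 f x) =
    (LINT x|unit_measure. \<psi> x *\<^sub>R rep_L2 g x))"

definition W22 :: "L2 set"
  where "W22 = {f. \<exists>g. weak_deriv2 f g}"

(* Meaningful on W22, where the second generalized derivative is unique as an element of L2. *)
definition gen_deriv2 :: "L2 \<Rightarrow> L2"
  where "gen_deriv2 f = (THE g. weak_deriv2 f g)"

(* Point values of f and f' at the end points are those of the representative of f
   that is continuously differentiable on the closed interval; component 1 is phi and
   component 2 is gamma. *)
definition C1_representative :: "L2 \<Rightarrow> (real \<Rightarrow> complex^2) \<Rightarrow> (real \<Rightarrow> complex^2) \<Rightarrow> bool"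
  where "C1_representative f u u' \<longleftrightarrow>
    ae_eq u (rep_L2 f) \<and>
    (\<forall>x\<in>{0..1}. (u has_vector_derivative u' x) (at x within {0..1})) \<and>
    continuous_on {0..1} u'"

definition dom_D :: "L2 set"
  where "dom_D = {f \<in> W22. \<exists>u u'. C1_representative f u u' \<and>
    u 0 $ 1 = 0 \<and> u 1 $ 1 = 0 \<and> u' 0 $ 2 = 0 \<and> u' 1 $ 2 = 0}"

definition op_AD :: "complex^2^2 \<Rightarrow> L2 \<Rightarrow> L2"
  where "op_AD A f = - matrix_L2 A (gen_deriv2 f)"

definition resolvent :: "L2 set \<Rightarrow> (L2 \<Rightarrow> L2) \<Rightarrow> complex \<Rightarrow> L2 \<Rightarrow> L2"
  where "resolvent X T z = inv_into X (\<lambda>f. T f - z *\<^sub>C f)"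

(* For a complex-linear T the inverse of T - z is complex-linear, so that bounded_linear,
   which refers to real scalars, only adds its boundedness. *)
definition spectrum :: "L2 set \<Rightarrow> (L2 \<Rightarrow> L2) \<Rightarrow> complex set"
  where "spectrum X T = {z. \<not> (bij_betw (\<lambda>f. T f - z *\<^sub>C f) X UNIV \<and>
    bounded_linear (resolvent X T z))}"

definition cinner_vec :: "complex^'n \<Rightarrow> complex^'n \<Rightarrow> complex"
  where "cinner_vec u v = (\<Sum>i\<in>UNIV. u $ i * cnj (v $ i))"

definition Num :: "complex^'n^'n \<Rightarrow> complex set"
  where "Num C = {cinner_vec (C *v v) v | v. norm v = 1}"

definition diagonal :: "'a::zero^'n^'n \<Rightarrow> bool"
  where "diagonal B \<longleftrightarrow> (\<forall>i j. i \<noteq> j \<longrightarrow> B $ i $ j = 0)"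

(* Any determination theta of the argument is allowed, as is_Arg z theta says only
   z = |z| exp(i theta). *)
definition sector :: "real \<Rightarrow> real \<Rightarrow> complex set"
  where "sector \<alpha> \<beta> = insert 0 {z. \<exists>\<theta>. \<alpha> \<le> \<theta> \<and> \<theta> \<le> \<beta> \<and> is_Arg z \<theta>}"

end

theory Submission
  imports Defs
begin

text \<open>Conjugating with a diagonal matrix preserves the boundary conditions, so \<open>B\<close> only enters through the
  weights \<open>r\<^sub>i = 1 / \<bar>B\<^sub>i\<^sub>i\<bar>\<^sup>2\<close>: for \<open>y = B v\<close>, \<open>\<langle>B\<^sup>-\<^sup>1AB v, v\<rangle>\<close> is \<open>Q(y) = \<Sum>\<^sub>i r\<^sub>i (A y)\<^sub>i cnj y\<^sub>i\<close>, which thus takes values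
  in the sector.
  If \<open>- A f'' - z f = h\<close>, pairing with \<open>f''\<close> in the weighted inner product gives
  \<open>\<integral> Q(f'') = z \<Sum>\<^sub>i r\<^sub>i \<parallel>f\<^sub>i'\<parallel>\<^sup>2 - \<integral> \<Sum>\<^sub>i r\<^sub>i h\<^sub>i cnj f\<^sub>i''\<close>.
  For \<open>z\<close> outside the sector a rotation moves \<open>z\<close> into the left half plane and the sector into a proper cone
  around the positive axis, and \<open>\<bar>Q(y)\<bar> \<ge> c \<bar>y\<bar>\<^sup>2\<close> because \<open>A\<close> is non-singular and a sector of angle less than \<open>\<pi>\<close>
  has its vertex as a corner. Hence \<open>\<parallel>f''\<parallel> \<le> C \<parallel>h\<parallel>\<close>, and \<open>z f = - h - A f''\<close> bounds \<open>\<bar>z\<bar> \<parallel>f\<parallel>\<close>.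
  Surjectivity follows from this injectivity by shooting, as the boundary value problem is a linear ODE.\<close>

section \<open>Smooth bump functions\<close>

primrec differentiable_times :: "nat \<Rightarrow> (real \<Rightarrow> real) \<Rightarrow> bool" where
  "differentiable_times 0 f \<longleftrightarrow> True"
| "differentiable_times (Suc n) f \<longleftrightarrow>
    (\<exists>f'. (\<forall>x. (f has_real_derivative f' x) (at x)) \<and> differentiable_times n f')"

lemma differentiable_times_SucI:
  assumes "\<And>x. (f has_real_derivative f' x) (at x)" "differentiable_times n f'"
  shows "differentiable_times (Suc n) f"
  using assms by auto

lemma differentiable_times_SucD: "differentiable_times (Suc n) f \<Longrightarrow> differentiable_times n f"
proof (induction n arbitrary: f)
  case (Suc n)
  then obtain f' where "\<And>x. (f has_real_derivative f' x) (at x)" "differentiable_times (Suc n) f'"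
    by (meson differentiable_times.simps(2))
  then show ?case
    using Suc.IH by (blast intro: differentiable_times_SucI)
qed simp

lemma differentiable_times_deriv:
  "differentiable_times (m + n) f \<Longrightarrow> differentiable_times m ((deriv ^^ n) f)"
proof (induction n arbitrary: f)
  case (Suc n)
  then have "differentiable_times (Suc (m + n)) f"
    by simp
  then obtain f' where f': "\<And>x. (f has_real_derivative f' x) (at x)" "differentiable_times (m + n) f'"
    by (meson differentiable_times.simps(2))
  from f'(1) have "deriv f = f'"
    by (intro ext DERIV_imp_deriv)
  then show ?case
    using Suc.IH[OF f'(2)] by (simp add: funpow_swap1)
qed simp

lemma differentiable_on_deriv_power:
  assumes "\<And>n. differentiable_times n f"
  shows "(deriv ^^ n) f differentiable_on UNIV"
proof -
  have "differentiable_times (Suc 0) ((deriv ^^ n) f)"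
    using assms by (intro differentiable_times_deriv)
  then obtain f' where "\<And>x. ((deriv ^^ n) f has_real_derivative f' x) (at x)"
    by auto
  then show ?thesis
    by (auto intro!: differentiable_at_withinI simp: differentiable_on_def real_differentiable_def)
qed

lemma differentiable_times_const: "differentiable_times n (\<lambda>x. c)"
proof (induction n arbitrary: c)
  case (Suc n)
  show ?case by (rule differentiable_times_SucI[OF _ Suc[of 0]]) auto
qed simp

lemma differentiable_times_add:
  "differentiable_times n f \<Longrightarrow> differentiable_times n g \<Longrightarrow> differentiable_times n (\<lambda>x. f x + g x)"
proof (induction n arbitrary: f g)
  case (Suc n)
  then obtain f' g' where fg: "\<And>x. (f has_real_derivative f' x) (at x)" "differentiable_times n f'"
    "\<And>x. (g has_real_derivative g' x) (at x)" "differentiable_times n g'"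
    by (meson differentiable_times.simps(2))
  show ?case
    by (rule differentiable_times_SucI[OF DERIV_add[OF fg(1,3)] Suc.IH[OF fg(2,4)]])
qed simp

lemma differentiable_times_mult:
  "differentiable_times n f \<Longrightarrow> differentiable_times n g \<Longrightarrow> differentiable_times n (\<lambda>x. f x * g x)"
proof (induction n arbitrary: f g)
  case (Suc n)
  then obtain f' g' where fg: "\<And>x. (f has_real_derivative f' x) (at x)" "differentiable_times n f'"
    "\<And>x. (g has_real_derivative g' x) (at x)" "differentiable_times n g'"
    by (meson differentiable_times.simps(2))
  have "differentiable_times n (\<lambda>x. f' x * g x + g' x * f x)"
    using fg Suc.prems[THEN differentiable_times_SucD]
    by (intro differentiable_times_add Suc.IH)
  then show ?case
    by (rule differentiable_times_SucI[OF DERIV_mult[OF fg(1,3)]])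
qed simp

lemma differentiable_times_affine:
  "differentiable_times n f \<Longrightarrow> differentiable_times n (\<lambda>x. f (c * x + d))"
proof (induction n arbitrary: f)
  case (Suc n)
  then obtain f' where f': "\<And>x. (f has_real_derivative f' x) (at x)" "differentiable_times n f'"
    by (meson differentiable_times.simps(2))
  have "((\<lambda>x. f (c * x + d)) has_real_derivative f' (c * x + d) * c) (at x)" for x
    by (rule DERIV_chain2[OF f'(1)]) (auto intro!: derivative_eq_intros)
  moreover have "differentiable_times n (\<lambda>x. f' (c * x + d) * c)"
    using Suc.IH[OF f'(2)] by (intro differentiable_times_mult differentiable_times_const)
  ultimately show ?case by (rule differentiable_times_SucI)
qed simp

definition flat_exp :: "nat \<Rightarrow> real \<Rightarrow> real"
  where "flat_exp m x = (if x > 0 then exp (- (1 / x)) / x ^ m else 0)"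

lemma flat_exp_le:
  assumes "x > 0"
  shows "flat_exp m x \<le> fact (m + 2) * x ^ 2"
proof -
  have "(\<Sum>k\<in>{m + 2}. (1 / x) ^ k /\<^sub>R fact k) \<le> (\<Sum>k. (1 / x) ^ k /\<^sub>R fact k)"
    using assms by (intro sum_le_suminf summable_exp_generic) auto
  then have "(1 / x) ^ (m + 2) / fact (m + 2) \<le> exp (1 / x)"
    by (simp add: exp_def divide_inverse mult.commute del: fact_Suc power_Suc add_2_eq_Suc')
  then have "inverse (exp (1 / x)) \<le> inverse ((1 / x) ^ (m + 2) / fact (m + 2))"
    using assms by (intro le_imp_inverse_le) simp_all
  then have "exp (- (1 / x)) \<le> fact (m + 2) * x ^ 2 * x ^ m"
    by (simp add: exp_minus power_divide power_add mult_ac del: fact_Suc power_Suc add_2_eq_Suc')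
  then show ?thesis
    using assms by (simp add: flat_exp_def pos_divide_le_eq del: fact_Suc)
qed

lemma DERIV_flat_exp:
  "(flat_exp m has_real_derivative flat_exp (m + 2) x - real m * flat_exp (m + 1) x) (at x)"
proof -
  consider "x > 0" | "x < 0" | "x = 0" by linarith
  then show ?thesis
  proof cases
    case 1
    have "((\<lambda>x. exp (- inverse x) * inverse x ^ m) has_real_derivative
        exp (- inverse x) * inverse x ^ 2 * inverse x ^ m
          - exp (- inverse x) * (real m * inverse x ^ (m - 1) * inverse x ^ 2)) (at x)"
      using 1 by (auto intro!: derivative_eq_intros simp: power2_eq_square)
    also have "real m * inverse x ^ (m - 1) * inverse x ^ 2 = real m * inverse x ^ (m + 1)"
      by (cases m) (simp_all add: power2_eq_square)
    also have "exp (- inverse x) * inverse x ^ 2 * inverse x ^ m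
          - exp (- inverse x) * (real m * inverse x ^ (m + 1))
        = flat_exp (m + 2) x - real m * flat_exp (m + 1) x"
      using 1 by (simp add: flat_exp_def power_add divide_inverse power_inverse mult_ac power2_eq_square)
    finally have "((\<lambda>x. exp (- inverse x) * inverse x ^ m) has_real_derivative
        flat_exp (m + 2) x - real m * flat_exp (m + 1) x) (at x)" .
    then show ?thesis
      by (rule has_field_derivative_transform_within_open[where S = "{0<..}"])
        (use 1 in \<open>auto simp: flat_exp_def divide_inverse power_inverse\<close>)
  next
    case 2
    have "((\<lambda>x. 0) has_real_derivative 0) (at x)" by simp
    then have "(flat_exp m has_real_derivative 0) (at x)"
      by (rule has_field_derivative_transform_within_open[where S = "{..<0}"])
        (use 2 in \<open>auto simp: flat_exp_def\<close>)
    then show ?thesis using 2 by (simp add: flat_exp_def)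
  next
    case 3
    have "((\<lambda>h. flat_exp m h / h) \<longlongrightarrow> 0) (at 0)"
    proof (rule Lim_null_comparison)
      show "\<forall>\<^sub>F h in at 0. norm (flat_exp m h / h) \<le> fact (m + 2) * \<bar>h\<bar>"
      proof (rule eventually_at_filter[THEN iffD2], rule always_eventually, intro allI impI)
        fix h :: real assume "h \<noteq> 0"
        show "norm (flat_exp m h / h) \<le> fact (m + 2) * \<bar>h\<bar>"
        proof (cases "h > 0")
          case True
          then have "0 \<le> flat_exp m h" by (simp add: flat_exp_def)
          then show ?thesis
            using flat_exp_le[OF True, of m] True by (simp add: field_simps power2_eq_square)
        next
          case False
          then have "flat_exp m h = 0" by (simp add: flat_exp_def)
          then show ?thesis by simp
        qed
      qed
      show "((\<lambda>h. fact (m + 2) * \<bar>h\<bar>) \<longlongrightarrow> (0::real)) (at 0)"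
        by (auto intro!: tendsto_eq_intros)
    qed
    then show ?thesis
      using 3 by (simp add: DERIV_def flat_exp_def)
  qed
qed

lemma differentiable_times_flat_exp: "differentiable_times n (flat_exp m)"
proof (induction n arbitrary: m)
  case (Suc n)
  have "differentiable_times n (\<lambda>x. flat_exp (m + 2) x + (- real m) * flat_exp (m + 1) x)"
    by (intro differentiable_times_add differentiable_times_mult differentiable_times_const Suc)
  then have "differentiable_times n (\<lambda>x. flat_exp (m + 2) x - real m * flat_exp (m + 1) x)"
    by simp
  then show ?case
    by (rule differentiable_times_SucI[OF DERIV_flat_exp])
qed simp

definition bump :: "real \<Rightarrow> real \<Rightarrow> nat \<Rightarrow> real \<Rightarrow> real"
  where "bump a b n x = flat_exp 0 (real n * (x - a)) * flat_exp 0 (real n * (b - x))"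

lemma differentiable_times_bump: "differentiable_times k (bump a b n)"
proof -
  have "differentiable_times k (\<lambda>x. flat_exp 0 (real n * x + (- real n * a)) *
      flat_exp 0 ((- real n) * x + real n * b))"
    by (intro differentiable_times_mult differentiable_times_affine differentiable_times_flat_exp)
  then show ?thesis
    by (simp add: bump_def[abs_def] algebra_simps)
qed

lemma bump_eq_0: "x \<notin> {a..b} \<Longrightarrow> bump a b n x = 0"
  by (auto simp: bump_def flat_exp_def zero_less_mult_iff)

lemma bump_nonneg: "0 \<le> bump a b n x"
  by (simp add: bump_def flat_exp_def)

lemma bump_le_1: "bump a b n x \<le> 1"
  unfolding bump_def by (intro mult_le_one) (auto simp: flat_exp_def)

lemma bump_shift: "bump (a + s) (b + s) n x = bump a b n (x - s)"
  by (simp add: bump_def algebra_simps)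

lemma test_function_bump:
  assumes "0 < a" "b < 1"
  shows "test_function (bump a b n)"
  unfolding test_function_def
proof (intro conjI allI exI[of _ "{a..b}"] impI)
  show "(deriv ^^ k) (bump a b n) differentiable_on UNIV" for k
    by (rule differentiable_on_deriv_power[OF differentiable_times_bump])
qed (use assms bump_eq_0 in auto)

lemma tendsto_bump: "(\<lambda>n. bump a b n x) \<longlonglongrightarrow> indicator {a<..<b} x"
proof -
  have *: "(\<lambda>n. flat_exp 0 (real n * y)) \<longlonglongrightarrow> (if y > 0 then 1 else 0)" for y
  proof (cases "y > 0")
    case True
    have "(\<lambda>n. exp (- (1 / (real n * y)))) \<longlonglongrightarrow> exp (- 0)"
      using tendsto_mult_left[OF lim_inverse_n, of "1 / y"] True
      by (intro tendsto_intros) (simp add: field_simps)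
    moreover have "\<forall>\<^sub>F n in sequentially. exp (- (1 / (real n * y))) = flat_exp 0 (real n * y)"
      using eventually_gt_at_top[of 0] by eventually_elim (use True in \<open>simp add: flat_exp_def\<close>)
    ultimately have "(\<lambda>n. flat_exp 0 (real n * y)) \<longlonglongrightarrow> exp (- 0)"
      by (rule Lim_transform_eventually)
    then show ?thesis
      using True by simp
  next
    case False
    then have "flat_exp 0 (real n * y) = 0" for n
      by (simp add: flat_exp_def zero_less_mult_iff)
    then show ?thesis using False by simp
  qed
  show ?thesis
    unfolding bump_def
    using tendsto_mult[OF *[of "x - a"] *[of "b - x"]]
    by (auto simp: indicator_def split: if_splits)
qed

lemma test_functionD:
  assumes "test_function \<psi>"
  shows "\<And>x. (\<psi> has_real_derivative deriv \<psi> x) (at x)"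
    "\<And>x. (deriv \<psi> has_real_derivative deriv (deriv \<psi>) x) (at x)"
    "continuous_on S \<psi>" "continuous_on S (deriv \<psi>)" "continuous_on S (deriv (deriv \<psi>))"
    "\<psi> 0 = 0" "\<psi> 1 = 0" "deriv \<psi> 0 = 0" "deriv \<psi> 1 = 0"
proof -
  have "(deriv ^^ n) \<psi> differentiable_on UNIV" for n
    using assms by (auto simp: test_function_def)
  from this[of 0] this[of 1] this[of 2]
  have d: "\<psi> differentiable_on UNIV" "deriv \<psi> differentiable_on UNIV"
    "deriv (deriv \<psi>) differentiable_on UNIV"
    by (simp_all add: numeral_2_eq_2)
  have D: "(g has_real_derivative deriv g x) (at x)" if "g differentiable_on UNIV" for g :: "real \<Rightarrow> real" and x
    using that by (simp add: differentiable_on_def DERIV_deriv_iff_real_differentiable)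
  obtain K where K: "compact K" "K \<subseteq> {0<..<1}" "\<And>x. x \<notin> K \<Longrightarrow> \<psi> x = 0"
    using assms by (auto simp: test_function_def)
  have "deriv \<psi> x = 0" if "x \<notin> K" for x
  proof -
    have "((\<lambda>x. 0) has_real_derivative 0) (at x)" by simp
    then have "(\<psi> has_real_derivative 0) (at x)"
      by (rule has_field_derivative_transform_within_open[where S = "- K"])
        (use K compact_imp_closed that in auto)
    then show ?thesis by (rule DERIV_imp_deriv)
  qed
  moreover have "0 \<notin> K" "1 \<notin> K" using K(2) by auto
  ultimately show "\<psi> 0 = 0" "\<psi> 1 = 0" "deriv \<psi> 0 = 0" "deriv \<psi> 1 = 0"
    using K(3) by auto
  show "\<And>x. (\<psi> has_real_derivative deriv \<psi> x) (at x)"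
    "\<And>x. (deriv \<psi> has_real_derivative deriv (deriv \<psi>) x) (at x)"
    by (intro D d)+
  show "continuous_on S \<psi>" "continuous_on S (deriv \<psi>)" "continuous_on S (deriv (deriv \<psi>))"
    by (rule continuous_on_subset[OF differentiable_imp_continuous_on[OF d(1)]]
        continuous_on_subset[OF differentiable_imp_continuous_on[OF d(2)]]
        continuous_on_subset[OF differentiable_imp_continuous_on[OF d(3)]], simp)+
qed

section \<open>Integration by parts for indefinite integrals\<close>

lemma finite_measure_unit: "finite_measure unit_measure"
  by (rule finite_measure_lebesgue_on) (simp add: lmeasurable_interval)

lemma LINT_unit_measure:
  fixes f :: "real \<Rightarrow> 'b::euclidean_space"
  assumes "integrable unit_measure f"
  shows "(LINT x|unit_measure. f x) = integral {0..1} f" and "f absolutely_integrable_on {0..1}"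
    and "f integrable_on {0..1}"
proof -
  have abs: "f absolutely_integrable_on {0<..<1}"
    using assms by (simp add: set_integrable_def integrable_restrict_space)
  show "(LINT x|unit_measure. f x) = integral {0..1} f"
    using lebesgue_integral_eq_integral[OF assms] by (simp add: integral_open_interval_real)
  have "f absolutely_integrable_on {0<..<1} \<longleftrightarrow> f absolutely_integrable_on {0..1}"
    by (rule absolutely_integrable_spike_set_eq; rule negligible_subset[of "{0, 1}"]) auto
  with abs show "f absolutely_integrable_on {0..1}" by simp
  then show "f integrable_on {0..1}"
    by (rule set_lebesgue_integral_eq_integral)
qed

lemma integrable_unit_measure_continuous:
  fixes f :: "real \<Rightarrow> 'b::euclidean_space"
  assumes "continuous_on {0..1} f"
  shows "integrable unit_measure f"
proof -
  have "f absolutely_integrable_on {0..1}"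
    using assms by (rule absolutely_integrable_continuous_real)
  then have "f absolutely_integrable_on {0<..<1}"
    by (rule set_integrable_subset) auto
  then show ?thesis
    by (rule absolutely_integrable_imp_integrable) auto
qed

lemma measurable_unit_continuous:
  fixes f :: "real \<Rightarrow> 'b::euclidean_space"
  shows "continuous_on {0..1} f \<Longrightarrow> f \<in> borel_measurable unit_measure"
  by (rule borel_measurable_integrable[OF integrable_unit_measure_continuous])

lemma square_integrable_continuous: "continuous_on {0..1} f \<Longrightarrow> square_integrable f"
  unfolding square_integrable_def
  by (intro conjI measurable_unit_continuous integrable_unit_measure_continuous)
    (auto intro!: continuous_intros)

lemma square_integrable_imp_integrable:
  assumes "square_integrable f"
  shows "integrable unit_measure f"
proof (rule Bochner_Integration.integrable_bound)
  interpret finite_measure unit_measure by (rule finite_measure_unit)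
  show "integrable unit_measure (\<lambda>x. 1 + (norm (f x))\<^sup>2)"
    using assms by (simp add: square_integrable_def)
  have "norm v \<le> 1 + (norm v)\<^sup>2" for v :: "complex^2"
    using zero_le_power2[of "norm v - 1"] norm_ge_zero[of v] unfolding power2_diff power_one mult_1_right by linarith
  then show "AE x in unit_measure. norm (f x) \<le> norm (1 + (norm (f x))\<^sup>2)"
    by (intro AE_I2) (simp add: abs_of_nonneg add_nonneg_nonneg)
qed (use assms in \<open>simp add: square_integrable_def\<close>)

lemma LINT_restrict_less:
  fixes g :: "real \<Rightarrow> 'b::euclidean_space"
  assumes g: "integrable unit_measure g" and t: "0 < t" "t < 1"
  shows "(LINT x|unit_measure. (if x < t then g x else 0)) = integral {0..t} g"
    "(LINT x|unit_measure. (if t < x then g x else 0)) = integral {t..1} g"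
proof -
  have m: "{..<t} \<in> sets lebesgue" "{t<..} \<in> sets lebesgue" by auto
  have *: "integrable unit_measure (\<lambda>x. if x \<in> S then g x else 0)" if "S \<in> sets lebesgue" for S
    by (rule Bochner_Integration.integrable_bound[OF g])
      (use that g in \<open>auto intro!: measurable_If_set simp: sets_restrict_space\<close>)
  have "(LINT x|unit_measure. (if x \<in> {..<t} then g x else 0))
      = integral {0<..<1} (\<lambda>x. if x \<in> {..<t} then g x else 0)"
    using lebesgue_integral_eq_integral[OF *[OF m(1)]] by simp
  also have "\<dots> = integral {0<..<1} (\<lambda>x. if x \<in> {0<..<t} then g x else 0)"
    by (rule integral_cong) auto
  also have "\<dots> = integral {0<..<t} g"
    using t by (simp only: integral_restrict_Int) (auto intro!: arg_cong[where f = "\<lambda>S. integral S g"])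
  finally show "(LINT x|unit_measure. (if x < t then g x else 0)) = integral {0..t} g"
    by (simp add: integral_open_interval_real)
  have "(LINT x|unit_measure. (if x \<in> {t<..} then g x else 0))
      = integral {0<..<1} (\<lambda>x. if x \<in> {t<..} then g x else 0)"
    using lebesgue_integral_eq_integral[OF *[OF m(2)]] by simp
  also have "\<dots> = integral {0<..<1} (\<lambda>x. if x \<in> {t<..<1} then g x else 0)"
    by (rule integral_cong) auto
  also have "\<dots> = integral {t<..<1} g"
    using t by (simp only: integral_restrict_Int) (auto intro!: arg_cong[where f = "\<lambda>S. integral S g"])
  finally show "(LINT x|unit_measure. (if t < x then g x else 0)) = integral {t..1} g"
    by (simp add: integral_open_interval_real)
qed

lemma continuous_on_indefinite_integral:
  fixes g :: "real \<Rightarrow> 'b::euclidean_space"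
  assumes "integrable unit_measure g"
  shows "continuous_on {0..1} (\<lambda>x. c + integral {0..x} g)"
  using LINT_unit_measure(3)[OF assms] by (intro continuous_intros indefinite_integral_continuous_1)

lemma integrable_bilinear_continuous:
  fixes p :: "real \<Rightarrow> 'a::euclidean_space" and g :: "real \<Rightarrow> 'b::euclidean_space"
    and prod :: "'a \<Rightarrow> 'b \<Rightarrow> 'c::euclidean_space"
  assumes prod: "bounded_bilinear prod"
    and p: "continuous_on {0..1} p" and g: "integrable unit_measure g"
  shows "integrable unit_measure (\<lambda>x. prod (p x) (g x))"
proof -
  obtain L where L: "\<And>a b. norm (prod a b) \<le> norm a * norm b * L" "L > 0"
    using bounded_bilinear.pos_bounded[OF prod] by blast
  have "compact (p ` {0..1})"
    using p by (intro compact_continuous_image) auto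
  then obtain K where K: "\<And>x. x \<in> {0..1} \<Longrightarrow> norm (p x) \<le> K"
    by (meson bounded_iff compact_imp_bounded imageI)
  show ?thesis
  proof (rule Bochner_Integration.integrable_bound)
    show "integrable unit_measure (\<lambda>x. K * norm (g x) * L)" using g by simp
    have "continuous_on UNIV (\<lambda>q. prod (fst q) (snd q))"
      by (intro bounded_bilinear.continuous_on[OF prod] continuous_intros)
    then show "(\<lambda>x. prod (p x) (g x)) \<in> borel_measurable unit_measure"
      by (rule borel_measurable_continuous_Pair[OF measurable_unit_continuous[OF p]
            borel_measurable_integrable[OF g]])
    show "AE x in unit_measure. norm (prod (p x) (g x)) \<le> norm (K * norm (g x) * L)"
    proof (rule AE_I2)
      fix x assume "x \<in> space unit_measure"
      then have "norm (p x) * norm (g x) * L \<le> K * norm (g x) * L"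
        using L(2) by (intro mult_right_mono K) auto
      also have "\<dots> \<le> norm (K * norm (g x) * L)" by simp
      finally show "norm (prod (p x) (g x)) \<le> norm (K * norm (g x) * L)"
        using L(1)[of "p x" "g x"] by linarith
    qed
  qed
qed

lemmas integrable_mult_continuous = integrable_bilinear_continuous[OF bounded_bilinear_mult]
lemmas integrable_scaleR_continuous = integrable_bilinear_continuous[OF bounded_bilinear_scaleR]

lemma LINT_cong_unit:
  fixes f g :: "real \<Rightarrow> 'b::{banach, second_countable_topology}"
  assumes "\<And>x. 0 < x \<Longrightarrow> x < 1 \<Longrightarrow> f x = g x"
  shows "(LINT x|unit_measure. f x) = (LINT x|unit_measure. g x)"
  using assms by (intro Bochner_Integration.integral_cong) auto

text \<open>Fubini on the triangle \<open>{(x, t). x < t}\<close>; \<open>g\<close> need not be continuous, so the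
  integration by parts of the library does not apply.\<close>

lemma LINT_by_parts:
  fixes p p' g G :: "real \<Rightarrow> complex"
  assumes p: "\<And>x. x \<in> {0..1} \<Longrightarrow> (p has_vector_derivative p' x) (at x within {0..1})"
    and p': "continuous_on {0..1} p'"
    and g: "integrable unit_measure g"
    and G: "\<And>x. x \<in> {0..1} \<Longrightarrow> G x = G 0 + integral {0..x} g"
  shows "(LINT x|unit_measure. p x * g x) = p 1 * G 1 - p 0 * G 0 - (LINT x|unit_measure. p' x * G x)"
proof -
  interpret finite_measure unit_measure by (rule finite_measure_unit)
  interpret pair_sigma_finite unit_measure unit_measure ..
  have p'i: "integrable unit_measure p'"
    by (rule integrable_unit_measure_continuous[OF p'])
  have pc: "continuous_on {0..1} p"
    by (rule continuous_on_vector_derivative[OF p])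
  have p'_int: "integral {t..1} p' = p 1 - p t" if "0 < t" "t < 1" for t
    by (rule integral_unique, rule fundamental_theorem_of_calculus)
      (use that in \<open>auto intro: has_vector_derivative_within_subset[OF p]\<close>)
  have p'_int01: "integral {0..1} p' = p 1 - p 0"
    by (rule integral_unique, rule fundamental_theorem_of_calculus) (auto intro: p)
  let ?F = "\<lambda>x t. (if x < t then p' t * g x else 0)"
  have [measurable]: "g \<in> borel_measurable unit_measure" "p' \<in> borel_measurable unit_measure"
    using g p'i by auto
  have [measurable]: "(\<lambda>x. x) \<in> borel_measurable unit_measure"
    by (rule measurable_unit_continuous) (rule continuous_on_id)
  have Fm: "case_prod ?F \<in> borel_measurable (unit_measure \<Otimes>\<^sub>M unit_measure)"
  proof -
    have "fst \<in> borel_measurable (unit_measure \<Otimes>\<^sub>M unit_measure)"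
      "snd \<in> borel_measurable (unit_measure \<Otimes>\<^sub>M unit_measure)"
      using measurable_compose[OF measurable_fst, of "\<lambda>x. x" unit_measure borel unit_measure]
        measurable_compose[OF measurable_snd, of "\<lambda>x. x" unit_measure borel unit_measure] by auto
    then have [measurable]: "{q \<in> space (unit_measure \<Otimes>\<^sub>M unit_measure). fst q < snd q}
        \<in> sets (unit_measure \<Otimes>\<^sub>M unit_measure)"
      by measurable
    have "(\<lambda>q. if fst q < snd q then p' (snd q) * g (fst q) else 0)
        \<in> borel_measurable (unit_measure \<Otimes>\<^sub>M unit_measure)"
      by measurable
    then show ?thesis by (simp add: case_prod_beta)
  qed
  have Fi: "integrable (unit_measure \<Otimes>\<^sub>M unit_measure) (case_prod ?F)"
  proof (rule Bochner_Integration.integrable_bound[OF _ Fm])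
    show "integrable (unit_measure \<Otimes>\<^sub>M unit_measure) (\<lambda>(x, t). p' t * g x)"
    proof (rule Fubini_integrable)
      show "(\<lambda>(x, t). p' t * g x) \<in> borel_measurable (unit_measure \<Otimes>\<^sub>M unit_measure)"
        by measurable
      show "integrable unit_measure (\<lambda>x. LINT t|unit_measure. norm (case (x, t) of (x, t) \<Rightarrow> p' t * g x))"
        using g p'i by (simp add: norm_mult)
      show "AE x in unit_measure. integrable unit_measure (\<lambda>t. case (x, t) of (x, t) \<Rightarrow> p' t * g x)"
        using g p'i by simp
    qed
  qed auto
  have "(LINT t|unit_measure. LINT x|unit_measure. ?F x t)
      = (LINT x|unit_measure. LINT t|unit_measure. ?F x t)"
    by (rule Fubini_integral[OF Fi])
  moreover have "(LINT t|unit_measure. LINT x|unit_measure. ?F x t)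
      = (LINT t|unit_measure. p' t * (G t - G 0))"
  proof (rule LINT_cong_unit)
    fix t :: real assume t: "0 < t" "t < 1"
    have "(LINT x|unit_measure. ?F x t) = (LINT x|unit_measure. p' t * (if x < t then g x else 0))"
      by (rule LINT_cong_unit) simp
    also have "\<dots> = p' t * integral {0..t} g"
      using LINT_restrict_less(1)[OF g t] by (simp del: if_cancel)
    finally show "(LINT x|unit_measure. ?F x t) = p' t * (G t - G 0)"
      using G[of t] t by simp
  qed
  moreover have "(LINT x|unit_measure. LINT t|unit_measure. ?F x t)
      = (LINT x|unit_measure. (p 1 - p x) * g x)"
  proof (rule LINT_cong_unit)
    fix x :: real assume x: "0 < x" "x < 1"
    have "(LINT t|unit_measure. ?F x t) = (LINT t|unit_measure. (if x < t then p' t else 0) * g x)"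
      by (rule LINT_cong_unit) simp
    also have "\<dots> = integral {x..1} p' * g x"
      using LINT_restrict_less(2)[OF p'i x] by simp
    finally show "(LINT t|unit_measure. ?F x t) = (p 1 - p x) * g x"
      using p'_int[OF x] by simp
  qed
  moreover have "(LINT t|unit_measure. p' t * (G t - G 0))
      = (LINT t|unit_measure. p' t * G t) - (p 1 - p 0) * G 0"
  proof -
    have "continuous_on {0..1} G"
      by (rule continuous_on_cong[THEN iffD2, OF refl G continuous_on_indefinite_integral[OF g]])
    then have "integrable unit_measure (\<lambda>t. p' t * G t)"
      using p' by (intro integrable_unit_measure_continuous continuous_intros)
    then show ?thesis
      using p'i p'_int01 LINT_unit_measure(1)[OF p'i] by (simp add: right_diff_distrib)
  qed
  moreover have "(LINT x|unit_measure. (p 1 - p x) * g x)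
      = p 1 * (G 1 - G 0) - (LINT x|unit_measure. p x * g x)"
    using G[of 1] LINT_unit_measure(1)[OF g] g integrable_mult_continuous[OF pc g]
    by (simp add: left_diff_distrib)
  ultimately have "p 1 * (G 1 - G 0) - (LINT x|unit_measure. p x * g x)
      = (LINT t|unit_measure. p' t * G t) - (p 1 - p 0) * G 0"
    by simp
  then show ?thesis
    by algebra
qed

section \<open>Weak second derivatives and continuously differentiable representatives\<close>

lemma square_integrable_rep_L2: "square_integrable (rep_L2 f)"
  using Quotient3_rep_reflp[OF Quotient3_L2, of f] by (simp add: ae_eq_def)

lemma ae_eq_rep_abs_L2: "square_integrable f \<Longrightarrow> ae_eq (rep_L2 (abs_L2 f)) f"
  using Quotient3_rel_rep[OF Quotient3_L2] Quotient3_abs_rep[OF Quotient3_L2]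
    Quotient3_rel[OF Quotient3_L2, of "rep_L2 (abs_L2 f)" f] Quotient3_rep_reflp[OF Quotient3_L2]
  by (simp add: ae_eq_def)

lemma ae_eq_imp_eq_L2: "ae_eq (rep_L2 f) (rep_L2 g) \<Longrightarrow> f = g"
  using Quotient3_rel_rep[OF Quotient3_L2] by blast

lemma integral_component_complex:
  fixes g :: "real \<Rightarrow> complex^2"
  assumes "integrable unit_measure g" "x \<in> {0..1}"
  shows "integral {0..x} g $ i = integral {0..x} (\<lambda>x. g x $ i)"
proof -
  have "g integrable_on {0..x}"
    using LINT_unit_measure(3)[OF assms(1)] assms(2) integrable_on_subinterval by fastforce
  from integral_linear[OF this bounded_linear_vec_nth[of i]]
  show ?thesis by (simp add: o_def)
qed

lemma LINT_component_complex:
  fixes g :: "real \<Rightarrow> complex^2"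
  assumes "integrable M g"
  shows "(LINT x|M. g x) $ i = (LINT x|M. g x $ i)" and "integrable M (\<lambda>x. g x $ i)"
  using integral_bounded_linear[OF bounded_linear_vec_nth assms]
    integrable_bounded_linear[OF bounded_linear_vec_nth assms] by simp_all

lemma LINT_scaleR_by_parts:
  fixes g G :: "real \<Rightarrow> complex^2" and p p' :: "real \<Rightarrow> real"
  assumes p: "\<And>x. (p has_real_derivative p' x) (at x)" "continuous_on {0..1} p'"
    and p01: "p 0 = 0" "p 1 = 0"
    and g: "integrable unit_measure g"
    and G: "\<And>x. x \<in> {0..1} \<Longrightarrow> G x = G 0 + integral {0..x} g"
  shows "(LINT x|unit_measure. p x *\<^sub>R g x) = - (LINT x|unit_measure. p' x *\<^sub>R G x)"
proof -
  have pc: "continuous_on {0..1} p"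
    using p(1) by (meson DERIV_isCont continuous_at_imp_continuous_on)
  have Gc: "continuous_on {0..1} G"
    by (rule continuous_on_cong[THEN iffD2, OF refl G continuous_on_indefinite_integral[OF g]])
  have 1: "integrable unit_measure (\<lambda>x. p x *\<^sub>R g x)"
    by (rule integrable_scaleR_continuous[OF pc g])
  have 2: "integrable unit_measure (\<lambda>x. p' x *\<^sub>R G x)"
    using p(2) Gc by (intro integrable_unit_measure_continuous continuous_intros)
  have "(LINT x|unit_measure. p x *\<^sub>R g x) $ i = - (LINT x|unit_measure. p' x *\<^sub>R G x) $ i" for i
  proof -
    have "(LINT x|unit_measure. complex_of_real (p x) * g x $ i)
        = of_real (p 1) * G 1 $ i - of_real (p 0) * G 0 $ i
          - (LINT x|unit_measure. of_real (p' x) * G x $ i)"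
    proof (rule LINT_by_parts)
      show "((\<lambda>x. complex_of_real (p x)) has_vector_derivative of_real (p' x)) (at x within {0..1})" for x
        using p(1)[of x]
        by (auto intro!: has_vector_derivative_of_real simp: has_real_derivative_iff_has_vector_derivative
            intro: has_vector_derivative_at_within)
      show "continuous_on {0..1} (\<lambda>x. complex_of_real (p' x))"
        using p(2) by (intro continuous_intros)
      show "integrable unit_measure (\<lambda>x. g x $ i)"
        by (rule LINT_component_complex(2)[OF g])
      show "G x $ i = G 0 $ i + integral {0..x} (\<lambda>x. g x $ i)" if "x \<in> {0..1}" for x
        using arg_cong[OF G[OF that], of "\<lambda>v. v $ i"] integral_component_complex[OF g that] by simp
    qed
    then show ?thesis
      unfolding LINT_component_complex(1)[OF 1] LINT_component_complex(1)[OF 2]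
      unfolding vector_scaleR_component
      by (simp add: p01 scaleR_conv_of_real[where 'a = complex])
  qed
  then show ?thesis by (simp add: vec_eq_iff)
qed

lemma tendsto_LINT_bump:
  fixes g :: "real \<Rightarrow> complex^2"
  assumes g: "integrable unit_measure g" and ab: "0 < a" "a < b" "b < 1"
  shows "(\<lambda>n. LINT x|unit_measure. bump a b n x *\<^sub>R g x) \<longlonglongrightarrow> integral {a..b} g"
proof -
  have m: "bump a b n \<in> borel_measurable unit_measure" for n
  proof (rule measurable_unit_continuous)
    have "test_function (bump a b n)" using ab by (intro test_function_bump) auto
    then show "continuous_on {0..1} (bump a b n)"
      by (rule test_functionD)
  qed
  have [measurable]: "{a<..<b} \<in> sets unit_measure"
    using ab by (auto simp: sets_restrict_space image_iff intro!: exI[of _ "{a<..<b}"])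
  have "(\<lambda>n. LINT x|unit_measure. bump a b n x *\<^sub>R g x)
      \<longlonglongrightarrow> (LINT x|unit_measure. indicator {a<..<b} x *\<^sub>R g x)"
  proof (rule integral_dominated_convergence[where w = "\<lambda>x. norm (g x)"])
    show "(\<lambda>x. indicator {a<..<b} x *\<^sub>R g x) \<in> borel_measurable unit_measure"
      using g by measurable
    show "(\<lambda>x. bump a b n x *\<^sub>R g x) \<in> borel_measurable unit_measure" for n
      using g m by measurable
    show "AE x in unit_measure. (\<lambda>n. bump a b n x *\<^sub>R g x) \<longlonglongrightarrow> indicator {a<..<b} x *\<^sub>R g x"
      by (intro AE_I2 tendsto_intros tendsto_bump)
    show "AE x in unit_measure. norm (bump a b n x *\<^sub>R g x) \<le> norm (g x)" for n
      using bump_nonneg[of a b n] bump_le_1[of a b n] by (intro AE_I2) (simp add: mult_left_le_one_le)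
  qed (use g in simp)
  also have "(LINT x|unit_measure. indicator {a<..<b} x *\<^sub>R g x)
      = integral {0<..<1} (\<lambda>x. if x \<in> {a<..<b} then g x else 0)"
  proof -
    have "integrable unit_measure (\<lambda>x. indicator {a<..<b} x *\<^sub>R g x)"
      using g by (intro integrable_mult_indicator) auto
    from lebesgue_integral_eq_integral[OF this] show ?thesis
      by (simp add: indicator_scaleR_eq_if)
  qed
  also have "\<dots> = integral {a<..<b} g"
    using ab by (simp only: integral_restrict_Int) (auto intro!: arg_cong[where f = "\<lambda>S. integral S g"])
  finally show ?thesis
    by (simp add: integral_open_interval_real)
qed

lemma integral_shift_interval:
  fixes k :: "real \<Rightarrow> complex^2"
  shows "integral {a + d..b + d} k = integral {a..b} (\<lambda>x. k (x + d))"
  using integral_shift_cbox_plus[of a b k d] by (simp add: o_def add.commute)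

text \<open>Differentiating \<open>\<integral> \<psi>(x - s) k(x) dx\<close> in \<open>s\<close> tests \<open>k\<close> against the derivative of a translated bump, so the
  integral is independent of \<open>s\<close>; then the bumps increase to an indicator function.\<close>

lemma eq_shift_of_weak_deriv_zero:
  fixes k :: "real \<Rightarrow> complex^2"
  assumes k: "continuous_on {0..1} k"
    and zero: "\<And>\<psi>. test_function \<psi> \<Longrightarrow> (LINT x|unit_measure. deriv \<psi> x *\<^sub>R k x) = 0"
    and abd: "0 < a" "a < b" "0 \<le> d" "b + d < 1"
  shows "integral {a..b} k = integral {a + d..b + d} k"
proof -
  have ki: "integrable unit_measure k"
    by (rule integrable_unit_measure_continuous[OF k])
  have "(LINT x|unit_measure. bump (a + d) (b + d) n x *\<^sub>R k x)
      = (LINT x|unit_measure. bump a b n x *\<^sub>R k x)" for n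
  proof -
    have test: "test_function (bump (a + s) (b + s) n)" if "s \<in> {0..d}" for s
      using that abd by (intro test_function_bump) auto
    have test0: "test_function (bump a b n)"
      using test[of 0] abd by simp
    note D = test_functionD(1)[OF test0] and cont = test_functionD(3,4)[OF test0, where S = UNIV]
    have deriv_shift: "deriv (bump (a + s) (b + s) n) x = deriv (bump a b n) (x - s)" for s x
    proof (rule DERIV_imp_deriv)
      have "((\<lambda>x. bump a b n (x - s)) has_real_derivative deriv (bump a b n) (x - s) * 1) (at x)"
        by (rule DERIV_chain2[OF D]) (auto intro!: derivative_eq_intros)
      then show "(bump (a + s) (b + s) n has_real_derivative deriv (bump a b n) (x - s)) (at x)"
        by (simp add: bump_shift fun_eq_iff[THEN iffD2, of "bump (a + s) (b + s) n" "\<lambda>x. bump a b n (x - s)"])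
    qed
    let ?f = "\<lambda>s x. bump a b n (x - s) *\<^sub>R k x"
    let ?f' = "\<lambda>s x. (- deriv (bump a b n) (x - s)) *\<^sub>R k x"
    have LINT_eq: "(LINT x|unit_measure. bump (a + s) (b + s) n x *\<^sub>R k x) = integral {0..1} (?f s)" for s
    proof -
      have "integrable unit_measure (?f s)"
        using k by (intro integrable_unit_measure_continuous continuous_intros
            continuous_on_compose2[OF cont(1)]) auto
      from LINT_unit_measure(1)[OF this] show ?thesis
        by (simp add: bump_shift)
    qed
    have D_int: "((\<lambda>s. integral (cbox 0 1) (?f s)) has_vector_derivative integral (cbox 0 1) (?f' s))
        (at s within {0..d})" if "s \<in> {0..d}" for s
    proof (rule leibniz_rule_vector_derivative)
      fix s x :: real
      have "((\<lambda>s. x - s) has_real_derivative - 1) (at s within {0..d})"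
        by (auto intro!: derivative_eq_intros)
      from DERIV_chain2[OF D this]
      have "((\<lambda>s. bump a b n (x - s)) has_real_derivative - deriv (bump a b n) (x - s)) (at s within {0..d})"
        by simp
      then show "((\<lambda>s. ?f s x) has_vector_derivative ?f' s x) (at s within {0..d})"
        by (auto intro!: derivative_eq_intros)
    next
      show "?f s integrable_on cbox 0 1" for s
        using k by (intro integrable_continuous continuous_intros continuous_on_compose2[OF cont(1)]) auto
      show "continuous_on ({0..d} \<times> cbox 0 1) (\<lambda>(s, x). ?f' s x)"
        unfolding case_prod_beta
        by (intro continuous_intros continuous_on_compose2[OF cont(2)] continuous_on_compose2[OF k]) auto
    qed (use that in auto)
    have "integral (cbox 0 1) (?f' s) = 0" if "s \<in> {0..d}" for s
    proof -
      have i: "integrable unit_measure (\<lambda>x. deriv (bump a b n) (x - s) *\<^sub>R k x)"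
        using k by (intro integrable_unit_measure_continuous continuous_intros
            continuous_on_compose2[OF cont(2)]) auto
      have "(LINT x|unit_measure. deriv (bump a b n) (x - s) *\<^sub>R k x) = 0"
        using zero[OF test[OF that]] by (simp add: deriv_shift)
      then show ?thesis
        using LINT_unit_measure(1)[OF i] by simp
    qed
    then have "((\<lambda>s. integral (cbox 0 1) (?f s)) has_vector_derivative 0) (at s within {0..d})"
      if "s \<in> {0..d}" for s
      using D_int[OF that] that by simp
    then obtain c where "\<And>s. s \<in> {0..d} \<Longrightarrow> integral (cbox 0 1) (?f s) = c"
      by (rule has_vector_derivative_zero_constant[OF convex_real_interval(5)]) auto
    from this[of 0] this[of d] show ?thesis
      using LINT_eq[of 0] LINT_eq[of d] abd by simp
  qed
  moreover have "(\<lambda>n. LINT x|unit_measure. bump (a + d) (b + d) n x *\<^sub>R k x) \<longlonglongrightarrow> integral {a + d..b + d} k"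
    "(\<lambda>n. LINT x|unit_measure. bump a b n x *\<^sub>R k x) \<longlonglongrightarrow> integral {a..b} k"
    using abd by (intro tendsto_LINT_bump[OF ki]; simp)+
  ultimately show ?thesis
    using LIMSEQ_unique by simp
qed

lemma du_Bois_Reymond:
  fixes k :: "real \<Rightarrow> complex^2"
  assumes k: "continuous_on {0..1} k"
    and zero: "\<And>\<psi>. test_function \<psi> \<Longrightarrow> (LINT x|unit_measure. deriv \<psi> x *\<^sub>R k x) = 0"
    and x: "x \<in> {0..1}"
  shows "k x = k 0"
proof -
  have eq: "k x = k y" if xy: "0 < x" "x < y" "y < 1" for x y
  proof -
    define d where "d = y - x"
    define a c where "a = x / 2" and "c = (x + (1 - d)) / 2"
    have d: "0 < a" "a < x" "x < c" "c + d < 1" "d > 0"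
      using xy by (auto simp: d_def a_def c_def field_simps)
    have c1: "continuous_on {a..c} k" and c2: "continuous_on {a..c} (\<lambda>x. k (x + d))"
      using d by (auto intro!: continuous_on_subset[OF k] continuous_on_compose2[OF k] continuous_intros)
    have z: "integral {a..b} (\<lambda>x. k x - k (x + d)) = 0" if "b \<in> {a..c}" for b
    proof (cases "b = a")
      case False
      have "continuous_on {a..b} k" "continuous_on {a..b} (\<lambda>x. k (x + d))"
        using c1 c2 that by (auto intro: continuous_on_subset)
      moreover have "integral {a..b} k = integral {a..b} (\<lambda>x. k (x + d))"
        unfolding integral_shift_interval[symmetric]
        by (rule eq_shift_of_weak_deriv_zero[OF k]) (use zero that False d in auto)
      ultimately show ?thesis
        by (subst Henstock_Kurzweil_Integration.integral_diff) (auto intro: integrable_continuous_real)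
    qed auto
    have "((\<lambda>u. integral {a..u} (\<lambda>x. k x - k (x + d))) has_vector_derivative (k x - k (x + d)))
        (at x within {a..c})"
      using c1 c2 d by (intro integral_has_vector_derivative continuous_intros) auto
    then have "((\<lambda>u. 0) has_vector_derivative (k x - k (x + d))) (at x within {a..c})"
      by (rule has_vector_derivative_transform[rotated 2]) (use z d in auto)
    moreover have "((\<lambda>u. 0) has_vector_derivative (0 :: complex^2)) (at x within {a..c})"
      by simp
    ultimately have "k x - k (x + d) = 0"
      using d by (intro vector_derivative_unique_within_closed_interval[of a c x "\<lambda>u. 0"]) auto
    then show ?thesis by (simp add: d_def)
  qed
  have inner: "k x = k (1/2)" if "x \<in> {0<..<1}" for x
  proof (cases x "1/2 :: real" rule: linorder_cases)
    case less
    then show ?thesis using that by (intro eq) auto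
  next
    case greater
    then show ?thesis using that by (intro eq[symmetric]) auto
  qed (rule arg_cong)
  have "k x = k (1/2)" if "x \<in> {0..1}" for x
  proof (rule continuous_constant_on_closure[of "{0<..<1}" k "k (1/2)" x])
    show "continuous_on (closure {0<..<1}) k" "x \<in> closure {0<..<1}"
      using k that by simp_all
  qed (rule inner)
  from this[OF x] this[of 0] show ?thesis by (metis atLeastAtMost_iff order_refl zero_le_one)
qed

lemma C1_representative_indefinite:
  assumes "C1_representative f u u'"
  shows "continuous_on {0..1} u'" "integrable unit_measure u'" "continuous_on {0..1} u"
    "x \<in> {0..1} \<Longrightarrow> u x = u 0 + integral {0..x} u'"
proof -
  have D: "\<And>x. x \<in> {0..1} \<Longrightarrow> (u has_vector_derivative u' x) (at x within {0..1})"
    and c: "continuous_on {0..1} u'"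
    using assms by (auto simp: C1_representative_def)
  show "continuous_on {0..1} u'" "integrable unit_measure u'" "continuous_on {0..1} u"
    using c integrable_unit_measure_continuous[OF c] continuous_on_vector_derivative[OF D] by auto
  show "u x = u 0 + integral {0..x} u'" if "x \<in> {0..1}"
  proof -
    have "(u' has_integral u x - u 0) {0..x}"
      by (rule fundamental_theorem_of_calculus)
        (use that in \<open>auto intro: has_vector_derivative_within_subset[OF D]\<close>)
    then show ?thesis by (simp add: integral_unique)
  qed
qed

lemma LINT_deriv2_rep_L2:
  assumes f: "C1_representative f u u'" and \<psi>: "test_function \<psi>"
  shows "(LINT x|unit_measure. deriv (deriv \<psi>) x *\<^sub>R rep_L2 f x)
    = - (LINT x|unit_measure. deriv \<psi> x *\<^sub>R u' x)"
proof -
  note u = C1_representative_indefinite[OF f]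
  have "(LINT x|unit_measure. deriv \<psi> x *\<^sub>R u' x)
      = - (LINT x|unit_measure. deriv (deriv \<psi>) x *\<^sub>R u x)"
    by (intro LINT_scaleR_by_parts test_functionD[OF \<psi>] u)
  moreover have "(LINT x|unit_measure. deriv (deriv \<psi>) x *\<^sub>R rep_L2 f x)
      = (LINT x|unit_measure. deriv (deriv \<psi>) x *\<^sub>R u x)"
  proof (rule integral_cong_AE)
    have [measurable]: "deriv (deriv \<psi>) \<in> borel_measurable unit_measure"
      by (intro measurable_unit_continuous test_functionD[OF \<psi>])
    have [measurable]: "rep_L2 f \<in> borel_measurable unit_measure" "u \<in> borel_measurable unit_measure"
      using square_integrable_rep_L2[of f] measurable_unit_continuous[OF u(3)]
      by (auto simp: square_integrable_def)
    show "(\<lambda>x. deriv (deriv \<psi>) x *\<^sub>R rep_L2 f x) \<in> borel_measurable unit_measure"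
      "(\<lambda>x. deriv (deriv \<psi>) x *\<^sub>R u x) \<in> borel_measurable unit_measure"
      by measurable
    have "AE x in unit_measure. u x = rep_L2 f x"
      using f by (auto simp: C1_representative_def ae_eq_def)
    then show "AE x in unit_measure. deriv (deriv \<psi>) x *\<^sub>R rep_L2 f x = deriv (deriv \<psi>) x *\<^sub>R u x"
      by eventually_elim simp
  qed
  ultimately show ?thesis by simp
qed

lemma weak_deriv2_iff:
  assumes f: "C1_representative f u u'"
  shows "weak_deriv2 f g \<longleftrightarrow> (\<forall>x\<in>{0..1}. u' x = u' 0 + integral {0..x} (rep_L2 g))"
proof
  note u = C1_representative_indefinite[OF f]
  have g: "integrable unit_measure (rep_L2 g)"
    by (rule square_integrable_imp_integrable[OF square_integrable_rep_L2])
  {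
    assume u': "\<forall>x\<in>{0..1}. u' x = u' 0 + integral {0..x} (rep_L2 g)"
    show "weak_deriv2 f g"
      unfolding weak_deriv2_def
    proof (intro allI impI)
      fix \<psi> assume \<psi>: "test_function \<psi>"
      have "(LINT x|unit_measure. \<psi> x *\<^sub>R rep_L2 g x) = - (LINT x|unit_measure. deriv \<psi> x *\<^sub>R u' x)"
        by (rule LINT_scaleR_by_parts[OF test_functionD(1,4,6,7)[OF \<psi>] g bspec[OF u']])
      then show "(LINT x|unit_measure. deriv (deriv \<psi>) x *\<^sub>R rep_L2 f x) = (LINT x|unit_measure. \<psi> x *\<^sub>R rep_L2 g x)"
        using LINT_deriv2_rep_L2[OF f \<psi>] by simp
    qed
  }
  assume w: "weak_deriv2 f g"
  let ?G = "\<lambda>x. integral {0..x} (rep_L2 g)"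
  have Gc: "continuous_on {0..1} ?G"
    using continuous_on_indefinite_integral[OF g, of 0] by simp
  have zero: "(LINT x|unit_measure. deriv \<psi> x *\<^sub>R (u' x - ?G x)) = 0" if \<psi>: "test_function \<psi>" for \<psi>
  proof -
    have d: "continuous_on {0..1} (deriv \<psi>)"
      by (rule test_functionD[OF \<psi>])
    have "(LINT x|unit_measure. \<psi> x *\<^sub>R rep_L2 g x) = - (LINT x|unit_measure. deriv \<psi> x *\<^sub>R ?G x)"
      using g by (intro LINT_scaleR_by_parts test_functionD[OF \<psi>]) auto
    moreover have "(LINT x|unit_measure. \<psi> x *\<^sub>R rep_L2 g x) = - (LINT x|unit_measure. deriv \<psi> x *\<^sub>R u' x)"
      using LINT_deriv2_rep_L2[OF f \<psi>] w \<psi> by (simp add: weak_deriv2_def)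
    moreover have "integrable unit_measure (\<lambda>x. deriv \<psi> x *\<^sub>R u' x)"
      "integrable unit_measure (\<lambda>x. deriv \<psi> x *\<^sub>R ?G x)"
      using d u(1) Gc by (auto intro!: integrable_unit_measure_continuous continuous_intros)
    ultimately show ?thesis
      by (simp add: scaleR_diff_right)
  qed
  have "u' x = u' 0 + ?G x" if "x \<in> {0..1}" for x
  proof -
    have "u' x = (u' x - ?G x) + ?G x" by simp
    also have "u' x - ?G x = u' 0 - ?G 0"
      by (rule du_Bois_Reymond[OF continuous_on_diff[OF u(1) Gc] zero that])
    finally show ?thesis by simp
  qed
  then show "\<forall>x\<in>{0..1}. u' x = u' 0 + integral {0..x} (rep_L2 g)"
    by blast
qed

lemma AE_zero_of_integral_zero:
  fixes r :: "real \<Rightarrow> complex^2"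
  assumes r: "integrable unit_measure r"
    and zero: "\<And>a b. 0 < a \<Longrightarrow> a < b \<Longrightarrow> b < 1 \<Longrightarrow> integral {a..b} r = 0"
  shows "AE x in unit_measure. r x = 0"
proof -
  define r' where "r' x = (if x \<in> {0..1} then r x else 0)" for x
  have "r' integrable_on UNIV"
    using LINT_unit_measure(3)[OF r] unfolding r'_def[abs_def] by (subst integrable_restrict_UNIV)
  then have "r' integrable_on cbox a b" for a b
    by (rule integrable_on_subcbox) simp
  then obtain N where N: "negligible N" and lim: "\<And>x e. \<lbrakk>x \<notin> N; 0 < e\<rbrakk> \<Longrightarrow>
      \<exists>d>0. \<forall>h. 0 < h \<and> h < d \<longrightarrow>
        norm (integral (cbox x (x + h *\<^sub>R One)) r' /\<^sub>R h ^ DIM(real) - r' x) < e"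
    using integrable_ccontinuous_explicit by blast
  have "r x = 0" if x: "x \<notin> N" "0 < x" "x < 1" for x
  proof (rule ccontr)
    assume "r x \<noteq> 0"
    then obtain d where d: "d > 0" "\<And>h. 0 < h \<Longrightarrow> h < d \<Longrightarrow>
        norm (integral (cbox x (x + h *\<^sub>R One)) r' /\<^sub>R h ^ DIM(real) - r' x) < norm (r x)"
      using lim[OF x(1), of "norm (r x)"] by auto
    define h where "h = min d (1 - x) / 2"
    have h: "0 < h" "h < d" "x + h < 1"
      using d x by (auto simp: h_def min_def field_simps)
    have "integral {x..x + h} r' = integral {x..x + h} r"
      using x h by (intro integral_cong) (auto simp: r'_def)
    also have "\<dots> = 0"
      using x h by (intro zero) auto
    finally show False
      using d(2)[OF h(1,2)] x by (simp add: r'_def)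
  qed
  moreover have "AE x in lebesgue. x \<notin> N"
    using N by (simp add: negligible_iff_null_sets AE_not_in)
  ultimately show ?thesis
    by (subst AE_restrict_space_iff) auto
qed

lemma weak_deriv2_unique:
  assumes "weak_deriv2 f g1" "weak_deriv2 f g2"
  shows "g1 = g2"
proof -
  let ?r = "\<lambda>x. rep_L2 g1 x - rep_L2 g2 x"
  have g: "integrable unit_measure (rep_L2 g1)" "integrable unit_measure (rep_L2 g2)"
    by (auto intro: square_integrable_imp_integrable square_integrable_rep_L2)
  have r: "integrable unit_measure ?r"
    using g by simp
  have "integral {a..b} ?r = 0" if ab: "0 < a" "a < b" "b < 1" for a b
  proof -
    have "(LINT x|unit_measure. bump a b n x *\<^sub>R ?r x) = 0" for n
    proof -
      have t: "test_function (bump a b n)"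
        using ab by (intro test_function_bump) auto
      then have c: "continuous_on {0..1} (bump a b n)"
        by (rule test_functionD)
      have "(LINT x|unit_measure. bump a b n x *\<^sub>R rep_L2 g1 x)
          = (LINT x|unit_measure. bump a b n x *\<^sub>R rep_L2 g2 x)"
        using assms t unfolding weak_deriv2_def by metis
      then show ?thesis
        using integrable_scaleR_continuous[OF c g(1)] integrable_scaleR_continuous[OF c g(2)]
        by (simp add: scaleR_diff_right)
    qed
    then show ?thesis
      using tendsto_LINT_bump[OF r ab] by (simp add: LIMSEQ_const_iff)
  qed
  then have "AE x in unit_measure. ?r x = 0"
    by (rule AE_zero_of_integral_zero[OF r])
  then show ?thesis
    by (intro ae_eq_imp_eq_L2) (simp add: ae_eq_def square_integrable_rep_L2)
qed

lemma gen_deriv2_eqI: "weak_deriv2 f g \<Longrightarrow> gen_deriv2 f = g"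
  unfolding gen_deriv2_def using weak_deriv2_unique by blast

section \<open>Linear Volterra equations\<close>

lemma volterra_solution:
  fixes p :: "real \<Rightarrow> 'a::euclidean_space"
  assumes L: "bounded_linear L" and p: "continuous_on {0..1} p"
  obtains W where "continuous_on {0..1} W"
    "\<And>x. x \<in> {0..1} \<Longrightarrow> W x = p x + integral {0..x} (\<lambda>t. L (W t))"
proof -
  obtain K where K: "\<And>v. norm (L v) \<le> norm v * K" "K > 0"
    using bounded_linear.pos_bounded[OF L] by blast
  have "compact (p ` {0..1})"
    using p by (intro compact_continuous_image) auto
  then obtain C where C: "\<And>x. x \<in> {0..1} \<Longrightarrow> norm (p x) \<le> C"
    by (meson bounded_iff compact_imp_bounded imageI)
  define V where "V f x = integral {0..x} (\<lambda>t. L (f t))" for f :: "real \<Rightarrow> 'a" and x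
  have L_cont: "continuous_on S (\<lambda>t. L (f t))" if "continuous_on S f" for f and S :: "real set"
    using that by (intro bounded_linear.continuous_on[OF L])
  have V_cont: "continuous_on {0..1} (V f)" if "continuous_on {0..1} f" for f
    unfolding V_def[abs_def]
    by (intro indefinite_integral_continuous_1 integrable_continuous_real L_cont that)
  define u where "u n = (V ^^ n) p" for n
  have u_Suc: "u (Suc n) x = integral {0..x} (\<lambda>t. L (u n t))" for n x
    by (simp add: u_def V_def)
  have u_cont: "continuous_on {0..1} (u n)" for n
    by (induction n) (simp_all add: u_def p V_cont)
  have u_bound: "norm (u n x) \<le> C * K ^ n * x ^ n / fact n" if "x \<in> {0..1}" for n x
    using that
  proof (induction n arbitrary: x)
    case 0
    then show ?case using C by (simp add: u_def)
  next
    case (Suc n)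
    let ?b = "\<lambda>t. K * (C * K ^ n * t ^ n / fact n)"
    have D: "((\<lambda>t. C * K ^ Suc n / fact (Suc n) * t ^ Suc n) has_real_derivative ?b t) (at t within {0..x})" for t
    proof -
      have eq: "C * K ^ Suc n / fact (Suc n) * (real (Suc n) * t ^ n) = ?b t"
        unfolding fact_Suc of_nat_mult by (simp del: of_nat_Suc)
      have "((\<lambda>t. t ^ Suc n) has_real_derivative real (Suc n) * t ^ n) (at t within {0..x})"
        by (rule DERIV_cong[OF DERIV_power_Suc[OF DERIV_ident]]) (simp del: power_Suc)
      from DERIV_cmult[OF this, of "C * K ^ Suc n / fact (Suc n)"] show ?thesis
        unfolding eq .
    qed
    from this[unfolded has_real_derivative_iff_has_vector_derivative]
    have "(?b has_integral C * K ^ Suc n / fact (Suc n) * x ^ Suc n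
        - C * K ^ Suc n / fact (Suc n) * 0 ^ Suc n) {0..x}"
      using Suc.prems by (intro fundamental_theorem_of_calculus) auto
    then have b: "?b integrable_on {0..x}" "integral {0..x} ?b = C * K ^ Suc n * x ^ Suc n / fact (Suc n)"
      by (auto simp: has_integral_iff simp del: fact_Suc)
    have "norm (u (Suc n) x) \<le> integral {0..x} ?b"
      unfolding u_Suc
    proof (rule integral_norm_bound_integral)
      show "(\<lambda>t. L (u n t)) integrable_on {0..x}"
        using Suc.prems
        by (intro integrable_continuous_real L_cont continuous_on_subset[OF u_cont]) auto
      fix t assume t: "t \<in> {0..x}"
      then have "norm (u n t) * K \<le> C * K ^ n * t ^ n / fact n * K"
        using Suc.prems K by (intro mult_right_mono Suc.IH) auto
      then show "norm (L (u n t)) \<le> ?b t"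
        using K(1)[of "u n t"] by (simp add: mult_ac)
    qed (rule b)
    then show ?case by (simp only: b)
  qed
  define W where "W x = (\<Sum>n. u n x)" for x
  have lim: "uniform_limit {0..1} (\<lambda>n x. \<Sum>i<n. u i x) W sequentially"
    unfolding W_def[abs_def]
  proof (rule Weierstrass_m_test)
    have C0: "C \<ge> 0" using order.trans[OF norm_ge_zero C[of 0]] by simp
    show "norm (u n x) \<le> C * (K ^ n /\<^sub>R fact n)" if "x \<in> {0..1}" for n x
    proof -
      have "C * K ^ n * x ^ n / fact n \<le> C * K ^ n * 1 / fact n"
        using that K C0 by (intro divide_right_mono mult_left_mono power_le_one) auto
      then show ?thesis
        using u_bound[OF that, of n] by (simp add: divide_inverse mult_ac)
    qed
    show "summable (\<lambda>n. C * (K ^ n /\<^sub>R fact n))"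
      by (intro summable_mult summable_exp_generic)
  qed
  have W_cont: "continuous_on {0..1} W"
    by (rule uniform_limit_theorem[OF _ lim]) (auto intro!: always_eventually continuous_on_sum u_cont)
  have "W x = p x + integral {0..x} (\<lambda>t. L (W t))" if x: "x \<in> {0..1}" for x
  proof -
    let ?S = "\<lambda>n t. L (\<Sum>i<n. u i t)"
    have "uniform_limit {0..x} (\<lambda>n t. \<Sum>i<n. u i t) W sequentially"
      using lim by (rule uniform_limit_on_subset) (use x in auto)
    then have ul: "uniform_limit {0..x} ?S (\<lambda>t. L (W t)) sequentially"
      by (rule bounded_linear.uniform_limit[OF L])
    have S_cont: "continuous_on {0..x} (u i)" for i
      using x by (intro continuous_on_subset[OF u_cont]) auto
    obtain I J where IJ: "\<And>n. (?S n has_integral I n) {0..x}"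
      "((\<lambda>t. L (W t)) has_integral J) {0..x}" "I \<longlonglongrightarrow> J"
      by (rule uniform_limit_integral[OF ul]) (auto intro!: L_cont continuous_on_sum S_cont)
    have "I n = (\<Sum>i<n. u (Suc i) x)" for n
    proof -
      have "?S n t = (\<Sum>i<n. L (u i t))" for t
        using linear_sum[OF bounded_linear.linear[OF L]] .
      then have "integral {0..x} (?S n) = (\<Sum>i<n. u (Suc i) x)"
        unfolding u_Suc
        by (simp add: integral_sum integrable_continuous_real L_cont S_cont)
      then show ?thesis using IJ(1)[of n] by (simp add: integral_unique)
    qed
    then have "(\<Sum>i<Suc n. u i x) = p x + I n" for n
      by (simp add: sum.lessThan_Suc_shift u_def del: sum.lessThan_Suc)
    moreover have "(\<lambda>n. \<Sum>i<Suc n. u i x) \<longlonglongrightarrow> W x"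
      by (rule LIMSEQ_Suc[OF tendsto_uniform_limitI[OF lim x]])
    ultimately have "(\<lambda>n. p x + I n) \<longlonglongrightarrow> W x" by simp
    moreover have "(\<lambda>n. p x + I n) \<longlonglongrightarrow> p x + J"
      by (intro tendsto_intros IJ)
    ultimately have "W x = p x + J"
      by (rule LIMSEQ_unique)
    then show ?thesis
      using IJ(2) by (simp add: integral_unique)
  qed
  then show thesis using that W_cont by blast
qed

section \<open>Sectors and weighted numerical ranges\<close>

lemma is_Arg_cis: "is_Arg z \<theta> \<longleftrightarrow> z = of_real (norm z) * cis \<theta>"
  by (simp add: is_Arg_def cis_conv_exp mult.commute)

lemma Re_cis_mult_is_Arg:
  assumes "is_Arg z \<theta>"
  shows "Re (cis (- \<omega>) * z) = cmod z * cos (\<theta> - \<omega>)"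
proof -
  have "cis (- \<omega>) * z = of_real (cmod z) * cis (\<theta> - \<omega>)"
    by (subst is_Arg_cis[THEN iffD1, OF assms]) (simp add: mult_ac cis_mult flip: mult.assoc)
  then show ?thesis by simp
qed

lemma sector_cone_bound:
  assumes s: "s \<in> sector \<alpha> \<beta>" and "\<omega> - \<rho> \<le> \<alpha>" "\<beta> \<le> \<omega> + \<rho>" and "\<rho> \<le> pi"
  shows "cos \<rho> * cmod s \<le> Re (cis (- \<omega>) * s)"
proof (cases "s = 0")
  case False
  then obtain \<theta> where \<theta>: "\<alpha> \<le> \<theta>" "\<theta> \<le> \<beta>" "is_Arg s \<theta>"
    using s by (auto simp: sector_def)
  have "cos \<rho> \<le> cos \<bar>\<theta> - \<omega>\<bar>"
    using assms \<theta> by (intro cos_monotone_0_pi_le) auto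
  then have "cos \<rho> \<le> cos (\<theta> - \<omega>)" by (simp only: cos_abs_real)
  then show ?thesis
    unfolding Re_cis_mult_is_Arg[OF \<theta>(3)] mult.commute[of "cos \<rho>"] by (rule mult_left_mono) simp
qed simp

lemma scaleR_sector:
  assumes "s \<in> sector \<alpha> \<beta>" "r \<ge> 0"
  shows "of_real r * s \<in> sector \<alpha> \<beta>"
proof (cases "s = 0")
  case False
  then obtain \<theta> where \<theta>: "\<alpha> \<le> \<theta>" "\<theta> \<le> \<beta>" "is_Arg s \<theta>"
    using assms by (auto simp: sector_def)
  have "is_Arg (of_real r * s) \<theta>"
    using \<theta>(3) assms(2) unfolding is_Arg_cis by (simp add: norm_mult mult.assoc)
  then show ?thesis using \<theta> by (auto simp: sector_def)
qed (simp add: sector_def)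

lemma not_in_sector_arg:
  assumes "z \<notin> sector \<alpha> \<beta>"
  obtains \<zeta> where "is_Arg z \<zeta>" "\<beta> < \<zeta>" "\<zeta> < \<alpha> + 2 * pi"
proof -
  define k where "k = \<lfloor>(Arg z - \<alpha>) / (2 * pi)\<rfloor>"
  define \<zeta> where "\<zeta> = Arg z - k * (2 * pi)"
  have z0: "z \<noteq> 0" using assms by (auto simp: sector_def)
  have "is_Arg z (\<zeta> + of_int k * (2 * pi))"
    using is_Arg_Arg[OF z0] by (simp add: \<zeta>_def)
  then have arg: "is_Arg z \<zeta>" by (simp only: is_Arg_2pi_iff)
  have "k \<le> (Arg z - \<alpha>) / (2 * pi)" "(Arg z - \<alpha>) / (2 * pi) < k + 1"
    unfolding k_def by linarith+
  then have "\<alpha> \<le> \<zeta>" "\<zeta> < \<alpha> + 2 * pi"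
    by (simp_all add: \<zeta>_def field_simps)
  moreover have "\<not> \<zeta> \<le> \<beta>"
    using assms arg \<open>\<alpha> \<le> \<zeta>\<close> by (auto simp: sector_def)
  ultimately show thesis
    using arg by (intro that[of \<zeta>]) auto
qed

lemma separating_direction:
  assumes z: "is_Arg z \<zeta>" and \<zeta>: "\<beta> + \<epsilon> \<le> \<zeta>" "\<zeta> \<le> \<alpha> - \<epsilon> + 2 * pi"
    and \<epsilon>: "0 \<le> \<epsilon>" "\<epsilon> \<le> (pi - (\<beta> - \<alpha>)) / 2"
  obtains \<omega> where "Re (cis \<omega> * z) \<le> 0"
    "\<And>s. s \<in> sector \<alpha> \<beta> \<Longrightarrow> sin \<epsilon> * cmod s \<le> Re (cis \<omega> * s)"
proof -
  define \<omega> where "\<omega> = max (\<beta> + \<epsilon> - pi / 2) (\<zeta> - 3 * pi / 2)"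
  have \<omega>: "\<beta> + \<epsilon> - pi / 2 \<le> \<omega>" "\<zeta> - 3 * pi / 2 \<le> \<omega>" "\<omega> \<le> \<alpha> + pi / 2 - \<epsilon>" "\<omega> \<le> \<zeta> - pi / 2"
    using \<zeta> \<epsilon> unfolding \<omega>_def by (simp_all add: max_def field_simps)
  have "0 \<le> cos (\<zeta> - \<omega> - pi)"
    using \<omega> by (intro cos_ge_zero) auto
  then have "cos (\<zeta> - \<omega>) \<le> 0"
    by simp
  then have "Re (cis (- \<omega>) * z) \<le> 0"
    unfolding Re_cis_mult_is_Arg[OF z] by (rule mult_nonneg_nonpos[OF norm_ge_zero])
  moreover have "sin \<epsilon> * cmod s \<le> Re (cis (- \<omega>) * s)" if "s \<in> sector \<alpha> \<beta>" for s
  proof -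
    have "cos (pi / 2 - \<epsilon>) * cmod s \<le> Re (cis (- \<omega>) * s)"
      using \<omega> \<epsilon> by (intro sector_cone_bound[OF that]) auto
    then show ?thesis by (simp add: cos_sin_eq)
  qed
  ultimately show thesis by (rule that)
qed

definition weighted_form :: "real^2 \<Rightarrow> complex^2^2 \<Rightarrow> complex^2 \<Rightarrow> complex^2 \<Rightarrow> complex"
  where "weighted_form r A x y = (\<Sum>i\<in>UNIV. of_real (r $ i) * (A *v x) $ i * cnj (y $ i))"

lemma matrix_inv_mult:
  assumes "invertible A"
  shows "matrix_inv A ** A = mat 1" "A ** matrix_inv A = mat 1"
  using someI_ex[of "\<lambda>A'. A ** A' = mat 1 \<and> A' ** A = mat 1"] assms
  unfolding invertible_def matrix_inv_def by blast+

lemma numerical_range_weights: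
  fixes A B :: "complex^2^2"
  assumes B: "invertible B" "diagonal B"
    and num: "Num (matrix_inv B ** A ** B) \<subseteq> sector \<alpha> \<beta>"
  obtains r where "\<And>i. 0 < r $ i" "\<And>y. weighted_form r A y y \<in> sector \<alpha> \<beta>"
proof -
  have Bi: "B ** matrix_inv B = mat 1" "matrix_inv B ** B = mat 1"
    using matrix_inv_mult[OF B(1)] by auto
  have diag: "(B *v w) $ i = B $ i $ i * w $ i" for w :: "complex^2" and i
    using B(2) unfolding matrix_vector_mult_def diagonal_def
    by (simp, subst sum.remove[of _ i]) (auto intro!: sum.neutral)
  have b0: "B $ i $ i \<noteq> 0" for i
  proof
    assume "B $ i $ i = 0"
    moreover have "(B *v (matrix_inv B *v axis i 1)) $ i = 1"
      by (simp add: matrix_vector_mul_assoc Bi axis_def)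
    ultimately show False by (simp add: diag)
  qed
  have inv: "(matrix_inv B *v x) $ i = x $ i / B $ i $ i" for x :: "complex^2" and i
  proof -
    have "B *v (matrix_inv B *v x) = x" by (simp add: matrix_vector_mul_assoc Bi)
    then show ?thesis using diag[of "matrix_inv B *v x" i] b0[of i] by (simp add: field_simps)
  qed
  define r :: "real^2" where "r = (\<chi> i. 1 / (cmod (B $ i $ i))\<^sup>2)"
  have "0 < r $ i" for i using b0 by (simp add: r_def)
  moreover have "weighted_form r A y y \<in> sector \<alpha> \<beta>" for y
  proof (cases "y = 0")
    case True
    then show ?thesis by (simp add: weighted_form_def sector_def)
  next
    case False
    define v where "v = matrix_inv B *v y"
    have Bv: "B *v v = y" by (simp add: v_def matrix_vector_mul_assoc Bi)
    then have v0: "v \<noteq> 0" using False by auto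
    let ?C = "matrix_inv B ** A ** B"
    let ?w = "(1 / norm v) *\<^sub>R v"
    have "cinner_vec (?C *v ?w) ?w \<in> sector \<alpha> \<beta>"
    proof -
      have "norm ?w = 1" using v0 by simp
      then show ?thesis using num unfolding Num_def by blast
    qed
    then have "of_real ((norm v)\<^sup>2) * cinner_vec (?C *v ?w) ?w \<in> sector \<alpha> \<beta>"
      by (rule scaleR_sector) simp
    also have "of_real ((norm v)\<^sup>2) * cinner_vec (?C *v ?w) ?w = cinner_vec (?C *v v) v"
    proof -
      have "?C *v ?w = (1 / norm v) *\<^sub>R (?C *v v)"
        by (rule linear_cmul[OF bounded_linear.linear[OF bounded_linear_matrix_vector_complex]])
      then show ?thesis
        using v0 unfolding cinner_vec_def
        by (simp add: sum_distrib_left scaleR_conv_of_real[where 'a = complex] field_simps power2_eq_square)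
    qed
    also have "cinner_vec (?C *v v) v = weighted_form r A y y"
    proof -
      have CE: "?C *v v = matrix_inv B *v (A *v y)"
        using Bv by (simp add: matrix_vector_mul_assoc[symmetric])
      have frac: "a / b * cnj (c / b) = of_real (1 / (cmod b)\<^sup>2) * a * cnj c" for a b c :: complex
        by (simp add: complex_norm_square[symmetric] del: of_real_power)
      show ?thesis
        unfolding cinner_vec_def CE weighted_form_def r_def
        unfolding v_def inv frac by simp
    qed
    finally show ?thesis .
  qed
  ultimately show thesis by (rule that)
qed

lemma matrix_vector_mult_scaleC: "(A :: complex^2^2) *v (c *s x) = c *s (A *v x)"
  by (simp add: vec_eq_iff matrix_vector_mult_def sum_distrib_left mult_ac)

lemma matrix_vector_mult_scaleR_complex: "(A :: complex^2^2) *v (t *\<^sub>R x) = t *\<^sub>R (A *v x)"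
  by (rule linear_cmul[OF bounded_linear.linear[OF bounded_linear_matrix_vector_complex]])

text \<open>A nonzero \<open>y\<close> with vanishing form would make \<open>t \<mapsto> weighted_form r A (y + t w) (y + t w)\<close>
  linear to first order at \<open>t = 0\<close>; staying in a proper cone for both signs of \<open>t\<close>, it has derivative \<open>0\<close>
  for every \<open>w\<close>, which forces \<open>A y = 0\<close>.\<close>

lemma weighted_form_eq_0:
  assumes r: "\<And>i. 0 < r $ i" and A: "invertible A" and \<kappa>: "\<kappa> > 0"
    and cone: "\<And>y. \<kappa> * cmod (weighted_form r A y y) \<le> Re (\<omega> * weighted_form r A y y)"
    and y: "weighted_form r A y y = 0"
  shows "y = 0"
proof -
  let ?Q = "weighted_form r A"
  have L0: "?Q y w + ?Q w y = 0" for w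
  proof (rule ccontr)
    let ?L = "?Q y w + ?Q w y" and ?q = "?Q w w"
    assume L: "?L \<noteq> 0"
    have expand: "?Q (y + t *\<^sub>R w) (y + t *\<^sub>R w) = of_real t * ?L + of_real (t\<^sup>2) * ?q" for t
    proof -
      have "?Q (y + t *\<^sub>R w) (y + t *\<^sub>R w) = ?Q y y + of_real t * ?L + of_real (t\<^sup>2) * ?q"
        unfolding weighted_form_def matrix_vector_right_distrib matrix_vector_mult_scaleR_complex
        by (simp add: sum_distrib_left sum.distrib[symmetric] scaleR_conv_of_real[where 'a = complex]
            algebra_simps power2_eq_square)
      then show ?thesis using y by simp
    qed
    have bound: "\<kappa> * cmod ?L \<le> t * (cmod \<omega> * cmod ?q)" if "t > 0" for t
    proof -
      let ?a = "of_real t * ?L + of_real (t\<^sup>2) * ?q" and ?b = "of_real (- t) * ?L + of_real ((- t)\<^sup>2) * ?q"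
      have "2 * t * (\<kappa> * cmod ?L) = \<kappa> * cmod (?a - ?b)"
      proof -
        have "?a - ?b = of_real (2 * t) * ?L" by (simp add: algebra_simps)
        then show ?thesis using that by (simp only: norm_mult norm_of_real) simp
      qed
      also have "\<dots> \<le> \<kappa> * (cmod ?a + cmod ?b)"
        using \<kappa> by (intro mult_left_mono norm_triangle_ineq4) auto
      also have "\<dots> \<le> Re (\<omega> * ?a) + Re (\<omega> * ?b)"
        using cone[of "y + t *\<^sub>R w"] cone[of "y + (- t) *\<^sub>R w"] unfolding expand distrib_left by linarith
      also have "\<dots> = Re (\<omega> * (?a + ?b))" by (simp only: distrib_left plus_complex.sel)
      also have "\<dots> \<le> cmod (\<omega> * (?a + ?b))" by (rule complex_Re_le_cmod)
      also have "?a + ?b = of_real (2 * t\<^sup>2) * ?q" by (simp add: algebra_simps)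
      also have "cmod (\<omega> * (of_real (2 * t\<^sup>2) * ?q)) = 2 * t * (t * (cmod \<omega> * cmod ?q))"
        by (simp only: norm_mult norm_of_real) (simp add: power2_eq_square)
      finally show ?thesis using that by simp
    qed
    define M where "M = cmod \<omega> * cmod ?q"
    define t where "t = \<kappa> * cmod ?L / (2 * (M + 1))"
    have M: "M \<ge> 0" by (simp add: M_def)
    have pos: "\<kappa> * cmod ?L > 0" using \<kappa> L by simp
    then have "t > 0" using M by (simp add: t_def)
    then have "\<kappa> * cmod ?L \<le> t * M" using bound by (simp add: M_def)
    also have "t * M = \<kappa> * cmod ?L * (M / (2 * (M + 1)))" by (simp add: t_def)
    also have "\<dots> < \<kappa> * cmod ?L * 1"
      using pos M by (intro mult_strict_left_mono) (auto simp: field_simps)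
    finally show False by simp
  qed
  have "?Q y (\<i> *s w) = - \<i> * ?Q y w" "?Q (\<i> *s w) y = \<i> * ?Q w y" for w
    unfolding weighted_form_def matrix_vector_mult_scaleC
    by (simp_all add: sum_distrib_left mult_ac sum_negf)
  then have "\<i> * (?Q w y - ?Q y w) = 0" for w
    using L0[of "\<i> *s w"] by (simp add: algebra_simps)
  then have "?Q w y = ?Q y w" for w by simp
  then have "?Q y (A *v y) = 0"
    using L0[of "A *v y"] by simp
  then have "(\<Sum>i\<in>UNIV. r $ i * (cmod ((A *v y) $ i))\<^sup>2) = 0"
    unfolding weighted_form_def mult.assoc complex_norm_square[symmetric]
    by (simp only: of_real_mult[symmetric] of_real_sum[symmetric] of_real_eq_0_iff)
  then have "\<forall>i. r $ i * (cmod ((A *v y) $ i))\<^sup>2 = 0"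
    using r by (subst (asm) sum_nonneg_eq_0_iff) (auto simp: less_imp_le)
  then have "A *v y = 0"
    using r by (simp add: vec_eq_iff) (metis less_irrefl)
  then have "matrix_inv A *v (A *v y) = 0" by simp
  then show "y = 0"
    using matrix_inv_mult(1)[OF A] by (simp add: matrix_vector_mul_assoc)
qed

lemma weighted_form_lower_bound:
  assumes r: "\<And>i. 0 < r $ i" and A: "invertible A" and \<kappa>: "\<kappa> > 0"
    and cone: "\<And>y. \<kappa> * cmod (weighted_form r A y y) \<le> Re (\<omega> * weighted_form r A y y)"
  obtains c where "c > 0" "\<And>y. c * (norm y)\<^sup>2 \<le> cmod (weighted_form r A y y)"
proof -
  let ?q = "\<lambda>y. cmod (weighted_form r A y y)"
  have "continuous_on (sphere 0 1) ?q"
    unfolding weighted_form_def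
    by (intro continuous_intros bounded_linear.continuous_on[OF bounded_linear_vec_nth]
        bounded_linear.continuous_on[OF bounded_linear_matrix_vector_complex])
  moreover have "sphere (0 :: complex^2) 1 \<noteq> {}" by simp
  ultimately obtain v where v: "v \<in> sphere 0 1" "\<And>y. y \<in> sphere 0 1 \<Longrightarrow> ?q v \<le> ?q y"
    using continuous_attains_inf[OF compact_sphere] by blast
  show thesis
  proof (rule that)
    have "v \<noteq> 0" using v(1) by auto
    then show "?q v > 0"
      using weighted_form_eq_0[OF r A \<kappa> cone, of v] by auto
    fix y :: "complex^2"
    show "?q v * (norm y)\<^sup>2 \<le> ?q y"
    proof (cases "y = 0")
      case False
      let ?w = "(1 / norm y) *\<^sub>R y"
      have w: "?w \<in> sphere 0 1" using False by simp
      have "y = norm y *\<^sub>R ?w" using False by simp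
      then have "weighted_form r A y y = weighted_form r A (norm y *\<^sub>R ?w) (norm y *\<^sub>R ?w)" by simp
      also have "\<dots> = of_real ((norm y)\<^sup>2) * weighted_form r A ?w ?w"
        unfolding weighted_form_def matrix_vector_mult_scaleR_complex
        by (simp add: sum_distrib_left scaleR_conv_of_real[where 'a = complex] power2_eq_square mult_ac)
      finally have "?q y = (norm y)\<^sup>2 * ?q ?w" by (simp only: norm_mult norm_of_real) simp
      then show ?thesis
        using v(2)[OF w] by (simp add: mult_left_mono mult.commute)
    qed (simp add: weighted_form_def)
  qed
qed

section \<open>The operator and the resolvent estimate\<close>

lemma abs_rep_L2: "abs_L2 (rep_L2 f) = f"
  by (rule Quotient3_abs_rep[OF Quotient3_L2])

lemma ae_eq_rep_L2_iff: "ae_eq F (rep_L2 f) \<longleftrightarrow> square_integrable F \<and> abs_L2 F = f"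
  using Quotient3_rel[OF Quotient3_L2, of F "rep_L2 f"] square_integrable_rep_L2[of f]
  by (auto simp: ae_eq_def abs_rep_L2)

lemma AE_rep_abs_L2: "square_integrable F \<Longrightarrow> AE x in unit_measure. rep_L2 (abs_L2 F) x = F x"
  using ae_eq_rep_abs_L2 by (simp add: ae_eq_def)

lemma AE_rep_L2_add: "AE x in unit_measure. rep_L2 (f + g) x = rep_L2 f x + rep_L2 g x"
  using AE_rep_abs_L2[OF square_integrable_add[OF square_integrable_rep_L2 square_integrable_rep_L2]]
  by (simp add: plus_L2_def)

lemma AE_rep_L2_diff: "AE x in unit_measure. rep_L2 (f - g) x = rep_L2 f x - rep_L2 g x"
  using AE_rep_abs_L2[OF square_integrable_diff[OF square_integrable_rep_L2 square_integrable_rep_L2]]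
  by (simp add: minus_L2_def)

lemma AE_rep_L2_uminus: "AE x in unit_measure. rep_L2 (- f) x = - rep_L2 f x"
  using AE_rep_abs_L2[OF square_integrable_minus[OF square_integrable_rep_L2]]
  by (simp add: uminus_L2_def)

lemma AE_rep_L2_scaleR: "AE x in unit_measure. rep_L2 (c *\<^sub>R f) x = c *\<^sub>R rep_L2 f x"
  using AE_rep_abs_L2[OF square_integrable_scaleR[OF square_integrable_rep_L2]]
  by (simp add: scaleR_L2_def)

lemma AE_rep_L2_scaleC: "AE x in unit_measure. rep_L2 (c *\<^sub>C f) x = c *s rep_L2 f x"
  using AE_rep_abs_L2[OF square_integrable_scaleC[OF square_integrable_rep_L2]]
  by (simp add: scaleC_L2_def)

lemma AE_rep_L2_matrix: "AE x in unit_measure. rep_L2 (matrix_L2 C f) x = C *v rep_L2 f x"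
  using AE_rep_abs_L2[OF square_integrable_matrix[OF square_integrable_rep_L2]]
  by (simp add: matrix_L2_def)

lemma L2_eqI:
  assumes "AE x in unit_measure. rep_L2 f x = rep_L2 g x"
  shows "f = g"
  using assms by (intro ae_eq_imp_eq_L2) (simp add: ae_eq_def square_integrable_rep_L2)

lemma power2_norm_L2: "(norm f)\<^sup>2 = (LINT x|unit_measure. (norm (rep_L2 f x))\<^sup>2)"
  by (simp add: norm_L2_def)

lemma norm_scaleC_L2: "norm (c *\<^sub>C f) = cmod c * norm f"
proof -
  have nv: "norm (c *s v) = cmod c * norm v" for v :: "complex^2"
    unfolding norm_vec_def by (simp add: norm_mult L2_set_right_distrib)
  have "AE x in unit_measure. (norm (rep_L2 (c *\<^sub>C f) x))\<^sup>2 = (cmod c)\<^sup>2 * (norm (rep_L2 f x))\<^sup>2"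
    using AE_rep_L2_scaleC[of c f] by eventually_elim (simp add: nv power_mult_distrib)
  then have "(norm (c *\<^sub>C f))\<^sup>2 = (LINT x|unit_measure. (cmod c)\<^sup>2 * (norm (rep_L2 f x))\<^sup>2)"
    unfolding power2_norm_L2
    by (rule integral_cong_AE[rotated 2])
      (use square_integrable_rep_L2[of f] square_integrable_rep_L2[of "c *\<^sub>C f"] in
        \<open>auto simp: square_integrable_def\<close>)
  also have "\<dots> = (cmod c * norm f)\<^sup>2"
    unfolding power_mult_distrib power2_norm_L2 by simp
  finally show ?thesis
    by (rule power2_eq_imp_eq) auto
qed

lemma norm_matrix_L2: "norm (matrix_L2 C f) \<le> onorm ((*v) C) * norm f"
proof (rule power2_le_imp_le)
  let ?K = "onorm ((*v) C)"
  have K: "0 \<le> ?K" by (rule onorm_pos_le[OF bounded_linear_matrix_vector_complex])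
  have "AE x in unit_measure. (norm (rep_L2 (matrix_L2 C f) x))\<^sup>2 \<le> ?K\<^sup>2 * (norm (rep_L2 f x))\<^sup>2"
    using AE_rep_L2_matrix[of C f]
  proof eventually_elim
    case (elim x)
    have "norm (C *v rep_L2 f x) \<le> ?K * norm (rep_L2 f x)"
      by (rule onorm[OF bounded_linear_matrix_vector_complex])
    then show ?case
      unfolding elim power_mult_distrib[symmetric] by (rule power_mono) simp
  qed
  then have "(norm (matrix_L2 C f))\<^sup>2 \<le> (LINT x|unit_measure. ?K\<^sup>2 * (norm (rep_L2 f x))\<^sup>2)"
    unfolding power2_norm_L2
    by (rule integral_mono_AE[rotated 2])
      (use square_integrable_rep_L2[of f] square_integrable_rep_L2[of "matrix_L2 C f"] in
        \<open>auto simp: square_integrable_def\<close>)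
  then show "(norm (matrix_L2 C f))\<^sup>2 \<le> (?K * norm f)\<^sup>2"
    unfolding power_mult_distrib power2_norm_L2 by simp
  show "0 \<le> ?K * norm f" using K by simp
qed

lemma C1_representative_add:
  assumes "C1_representative f u u'" "C1_representative g v v'"
  shows "C1_representative (f + g) (\<lambda>x. u x + v x) (\<lambda>x. u' x + v' x)"
proof -
  have "square_integrable (\<lambda>x. u x + v x)" "abs_L2 (\<lambda>x. u x + v x) = f + g"
  proof -
    have uv: "square_integrable u" "square_integrable v" "abs_L2 u = f" "abs_L2 v = g"
      using assms unfolding C1_representative_def ae_eq_rep_L2_iff by auto
    then show "square_integrable (\<lambda>x. u x + v x)" by (intro square_integrable_add)
    show "abs_L2 (\<lambda>x. u x + v x) = f + g"
      using uv plus_L2.abs_eq[of u v] by (simp add: ae_eq_def)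
  qed
  then show ?thesis
    using assms unfolding C1_representative_def ae_eq_rep_L2_iff
    by (auto intro!: derivative_intros continuous_intros)
qed

lemma C1_representative_scaleR:
  assumes "C1_representative f u u'"
  shows "C1_representative (c *\<^sub>R f) (\<lambda>x. c *\<^sub>R u x) (\<lambda>x. c *\<^sub>R u' x)"
proof -
  have "square_integrable (\<lambda>x. c *\<^sub>R u x)" "abs_L2 (\<lambda>x. c *\<^sub>R u x) = c *\<^sub>R f"
  proof -
    have u: "square_integrable u" "abs_L2 u = f"
      using assms unfolding C1_representative_def ae_eq_rep_L2_iff by auto
    then show "square_integrable (\<lambda>x. c *\<^sub>R u x)" by (intro square_integrable_scaleR)
    show "abs_L2 (\<lambda>x. c *\<^sub>R u x) = c *\<^sub>R f"
      using u scaleR_L2.abs_eq[of u c] by (simp add: ae_eq_def)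
  qed
  then show ?thesis
    using assms unfolding C1_representative_def ae_eq_rep_L2_iff
    by (auto intro!: continuous_intros has_vector_derivative_scaleR[OF DERIV_const, simplified])
qed

lemma integral_rep_L2_cong:
  assumes "square_integrable F" "AE x in unit_measure. rep_L2 f x = F x" "x \<in> {0..1}"
  shows "integral {0..x} (rep_L2 f) = integral {0..x} F"
proof -
  have "AE x in lebesgue. x \<in> {0<..<1} \<longrightarrow> rep_L2 f x = F x"
    using assms(2) by (subst (asm) AE_restrict_space_iff) auto
  then obtain N where N: "{x \<in> space lebesgue. \<not> (x \<in> {0<..<1} \<longrightarrow> rep_L2 f x = F x)} \<subseteq> N"
    "emeasure lebesgue N = 0" "N \<in> sets lebesgue"
    by (rule AE_E)
  then have "negligible N"
    unfolding negligible_iff_null_sets by (intro null_setsI)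
  then have "negligible (N \<union> {0, 1})"
    by (rule negligible_Un[OF _ negligible_finite]) simp
  then show ?thesis
  proof (rule integral_spike)
    fix t assume "t \<in> {0..x} - (N \<union> {0, 1})"
    then have "t \<in> {0<..<1}" "t \<notin> N" using assms(3) by auto
    then show "F t = rep_L2 f t" using N(1) by auto
  qed
qed

lemma dom_DE:
  assumes "f \<in> dom_D"
  obtains u u' where "C1_representative f u u'" "u 0 $ 1 = 0" "u 1 $ 1 = 0" "u' 0 $ 2 = 0" "u' 1 $ 2 = 0"
    "\<forall>x\<in>{0..1}. u' x = u' 0 + integral {0..x} (rep_L2 (gen_deriv2 f))"
proof -
  obtain g where "weak_deriv2 f g" using assms by (auto simp: dom_D_def W22_def)
  then have g: "weak_deriv2 f (gen_deriv2 f)" using gen_deriv2_eqI by simp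
  obtain u u' where "C1_representative f u u'" "u 0 $ 1 = 0" "u 1 $ 1 = 0" "u' 0 $ 2 = 0" "u' 1 $ 2 = 0"
    using assms by (auto simp: dom_D_def)
  then show thesis
    using weak_deriv2_iff[of f u u' "gen_deriv2 f"] g that by blast
qed

lemma dom_DI:
  assumes f: "C1_representative f u u'" and "u 0 $ 1 = 0" "u 1 $ 1 = 0" "u' 0 $ 2 = 0" "u' 1 $ 2 = 0"
    and "\<And>x. x \<in> {0..1} \<Longrightarrow> u' x = u' 0 + integral {0..x} (rep_L2 g)"
  shows "f \<in> dom_D" "gen_deriv2 f = g"
proof -
  have "weak_deriv2 f g" using weak_deriv2_iff[OF f] assms(6) by blast
  then show "gen_deriv2 f = g" by (rule gen_deriv2_eqI)
  show "f \<in> dom_D" using assms(1-5) \<open>weak_deriv2 f g\<close> unfolding dom_D_def W22_def by blast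
qed

lemma integrable_on_rep_L2: "x \<in> {0..1} \<Longrightarrow> rep_L2 f integrable_on {0..x}"
  using LINT_unit_measure(3)[OF square_integrable_imp_integrable[OF square_integrable_rep_L2, of f]]
  by (rule integrable_on_subinterval) auto

lemma dom_D_add:
  assumes "f \<in> dom_D" "g \<in> dom_D"
  shows "f + g \<in> dom_D" "gen_deriv2 (f + g) = gen_deriv2 f + gen_deriv2 g"
proof -
  obtain u u' where u: "C1_representative f u u'" "u 0 $ 1 = 0" "u 1 $ 1 = 0" "u' 0 $ 2 = 0" "u' 1 $ 2 = 0"
    "\<forall>x\<in>{0..1}. u' x = u' 0 + integral {0..x} (rep_L2 (gen_deriv2 f))"
    using assms(1) by (rule dom_DE)
  obtain v v' where v: "C1_representative g v v'" "v 0 $ 1 = 0" "v 1 $ 1 = 0" "v' 0 $ 2 = 0" "v' 1 $ 2 = 0"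
    "\<forall>x\<in>{0..1}. v' x = v' 0 + integral {0..x} (rep_L2 (gen_deriv2 g))"
    using assms(2) by (rule dom_DE)
  have "u' x + v' x = u' 0 + v' 0 + integral {0..x} (rep_L2 (gen_deriv2 f + gen_deriv2 g))"
    if "x \<in> {0..1}" for x
  proof -
    have "integral {0..x} (rep_L2 (gen_deriv2 f + gen_deriv2 g))
        = integral {0..x} (\<lambda>x. rep_L2 (gen_deriv2 f) x + rep_L2 (gen_deriv2 g) x)"
      by (intro integral_rep_L2_cong AE_rep_L2_add that square_integrable_add square_integrable_rep_L2)
    also have "\<dots> = integral {0..x} (rep_L2 (gen_deriv2 f)) + integral {0..x} (rep_L2 (gen_deriv2 g))"
      using that by (intro Henstock_Kurzweil_Integration.integral_add integrable_on_rep_L2)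
    finally show ?thesis
      by (subst bspec[OF u(6) that], subst bspec[OF v(6) that]) simp
  qed
  from dom_DI[OF C1_representative_add[OF u(1) v(1)] _ _ _ _ this] u(2-5) v(2-5)
  show "f + g \<in> dom_D" "gen_deriv2 (f + g) = gen_deriv2 f + gen_deriv2 g" by simp_all
qed

lemma dom_D_scaleR:
  assumes "f \<in> dom_D"
  shows "c *\<^sub>R f \<in> dom_D" "gen_deriv2 (c *\<^sub>R f) = c *\<^sub>R gen_deriv2 f"
proof -
  obtain u u' where u: "C1_representative f u u'" "u 0 $ 1 = 0" "u 1 $ 1 = 0" "u' 0 $ 2 = 0" "u' 1 $ 2 = 0"
    "\<forall>x\<in>{0..1}. u' x = u' 0 + integral {0..x} (rep_L2 (gen_deriv2 f))"
    using assms(1) by (rule dom_DE)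
  have "c *\<^sub>R u' x = c *\<^sub>R u' 0 + integral {0..x} (rep_L2 (c *\<^sub>R gen_deriv2 f))"
    if "x \<in> {0..1}" for x
  proof -
    have "integral {0..x} (rep_L2 (c *\<^sub>R gen_deriv2 f)) = integral {0..x} (\<lambda>x. c *\<^sub>R rep_L2 (gen_deriv2 f) x)"
      by (intro integral_rep_L2_cong AE_rep_L2_scaleR that square_integrable_scaleR square_integrable_rep_L2)
    then show ?thesis
      by (subst bspec[OF u(6) that]) (simp add: scaleR_add_right)
  qed
  from dom_DI[OF C1_representative_scaleR[OF u(1)] _ _ _ _ this] u(2-5)
  show "c *\<^sub>R f \<in> dom_D" "gen_deriv2 (c *\<^sub>R f) = c *\<^sub>R gen_deriv2 f" by simp_all
qed

definition shifted_AD :: "complex^2^2 \<Rightarrow> complex \<Rightarrow> L2 \<Rightarrow> L2"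
  where "shifted_AD A z f = op_AD A f - z *\<^sub>C f"

lemma AE_rep_shifted_AD:
  "AE x in unit_measure. rep_L2 (shifted_AD A z f) x = - (A *v rep_L2 (gen_deriv2 f) x) - z *s rep_L2 f x"
  using AE_rep_L2_diff[of "op_AD A f" "z *\<^sub>C f"] AE_rep_L2_uminus[of "matrix_L2 A (gen_deriv2 f)"]
    AE_rep_L2_matrix[of A "gen_deriv2 f"] AE_rep_L2_scaleC[of z f]
  unfolding shifted_AD_def op_AD_def by eventually_elim simp

lemma shifted_AD_add:
  assumes "f \<in> dom_D" "g \<in> dom_D"
  shows "shifted_AD A z (f + g) = shifted_AD A z f + shifted_AD A z g"
proof (rule L2_eqI)
  show "AE x in unit_measure. rep_L2 (shifted_AD A z (f + g)) x
      = rep_L2 (shifted_AD A z f + shifted_AD A z g) x"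
    using AE_rep_shifted_AD[of A z "f + g"] AE_rep_shifted_AD[of A z f] AE_rep_shifted_AD[of A z g]
      AE_rep_L2_add[of "shifted_AD A z f" "shifted_AD A z g"] AE_rep_L2_add[of f g]
      AE_rep_L2_add[of "gen_deriv2 f" "gen_deriv2 g"]
    unfolding dom_D_add(2)[OF assms]
    by eventually_elim (simp add: matrix_vector_right_distrib vector_add_ldistrib)
qed

lemma shifted_AD_scaleR:
  assumes "f \<in> dom_D"
  shows "shifted_AD A z (c *\<^sub>R f) = c *\<^sub>R shifted_AD A z f"
proof (rule L2_eqI)
  have *: "z *s (c *\<^sub>R v) = c *\<^sub>R (z *s v)" for v :: "complex^2"
    by (simp add: vec_eq_iff)
  show "AE x in unit_measure. rep_L2 (shifted_AD A z (c *\<^sub>R f)) x = rep_L2 (c *\<^sub>R shifted_AD A z f) x"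
    using AE_rep_shifted_AD[of A z "c *\<^sub>R f"] AE_rep_shifted_AD[of A z f]
      AE_rep_L2_scaleR[of c "shifted_AD A z f"] AE_rep_L2_scaleR[of c f]
      AE_rep_L2_scaleR[of c "gen_deriv2 f"]
    unfolding dom_D_scaleR(2)[OF assms]
    by eventually_elim (simp add: matrix_vector_mult_scaleR_complex * scaleR_diff_right)
qed

lemma LINT_deriv2_mult_cnj:
  assumes u: "C1_representative f u u'"
    and g: "integrable unit_measure g" "\<And>x. x \<in> {0..1} \<Longrightarrow> u' x = u' 0 + integral {0..x} g"
    and bc: "u 0 $ i = 0 \<and> u 1 $ i = 0 \<or> u' 0 $ i = 0 \<and> u' 1 $ i = 0"
  shows "(LINT x|unit_measure. u x $ i * cnj (g x $ i)) = - of_real (LINT x|unit_measure. (cmod (u' x $ i))\<^sup>2)"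
    and "integrable unit_measure (\<lambda>x. u x $ i * cnj (g x $ i))"
proof -
  note c = C1_representative_indefinite[OF u]
  have gi: "integrable unit_measure (\<lambda>x. cnj (g x $ i))"
    using LINT_component_complex(2)[OF g(1), of i] by simp
  have "(LINT x|unit_measure. u x $ i * cnj (g x $ i))
      = u 1 $ i * cnj (u' 1 $ i) - u 0 $ i * cnj (u' 0 $ i) - (LINT x|unit_measure. u' x $ i * cnj (u' x $ i))"
  proof (rule LINT_by_parts)
    show "((\<lambda>x. u x $ i) has_vector_derivative u' x $ i) (at x within {0..1})" if "x \<in> {0..1}" for x
      using u that by (auto simp: C1_representative_def intro: bounded_linear.has_vector_derivative[OF bounded_linear_vec_nth])
    show "continuous_on {0..1} (\<lambda>x. u' x $ i)"
      by (rule bounded_linear.continuous_on[OF bounded_linear_vec_nth c(1)])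
    show "cnj (u' x $ i) = cnj (u' 0 $ i) + integral {0..x} (\<lambda>x. cnj (g x $ i))" if "x \<in> {0..1}" for x
    proof -
      have "(\<lambda>x. g x $ i) integrable_on {0..1}"
        by (rule LINT_unit_measure(3)[OF LINT_component_complex(2)[OF g(1)]])
      then have "(\<lambda>x. g x $ i) integrable_on {0..x}"
        by (rule integrable_on_subinterval) (use that in auto)
      from integral_linear[OF this bounded_linear_cnj]
      show ?thesis
        by (subst g(2)[OF that]) (simp add: o_def integral_component_complex[OF g(1) that])
    qed
  qed (rule gi)
  also have "u 1 $ i * cnj (u' 1 $ i) - u 0 $ i * cnj (u' 0 $ i) = 0"
    using bc by auto
  finally show "(LINT x|unit_measure. u x $ i * cnj (g x $ i)) = - of_real (LINT x|unit_measure. (cmod (u' x $ i))\<^sup>2)"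
    by (simp add: complex_norm_square[symmetric] integral_complex_of_real del: of_real_power)
  show "integrable unit_measure (\<lambda>x. u x $ i * cnj (g x $ i))"
    by (rule integrable_mult_continuous[OF bounded_linear.continuous_on[OF bounded_linear_vec_nth c(3)] gi])
qed

lemma norm_gen_deriv2_le:
  assumes r: "\<And>i. 0 < r $ i" and \<kappa>: "\<kappa> > 0"
    and coercive: "\<And>y. \<kappa> * (norm y)\<^sup>2 \<le> Re (cis \<omega> * weighted_form r A y y)"
    and z: "Re (cis \<omega> * z) \<le> 0"
    and f: "f \<in> dom_D"
  shows "norm (gen_deriv2 f) \<le> (\<Sum>i\<in>UNIV. r $ i) / \<kappa> * norm (shifted_AD A z f)"
proof -
  obtain u u' where u: "C1_representative f u u'" "u 0 $ 1 = 0" "u 1 $ 1 = 0" "u' 0 $ 2 = 0" "u' 1 $ 2 = 0"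
    "\<forall>x\<in>{0..1}. u' x = u' 0 + integral {0..x} (rep_L2 (gen_deriv2 f))"
    using f by (rule dom_DE)
  define g h where "g = rep_L2 (gen_deriv2 f)" and "h = rep_L2 (shifted_AD A z f)"
  define R where "R = (\<Sum>i\<in>UNIV. r $ i)"
  have R: "0 < R" unfolding R_def by (rule sum_pos) (use r in auto)
  have gs: "square_integrable g" and hs: "square_integrable h"
    by (simp_all add: g_def h_def square_integrable_rep_L2)
  have gi: "integrable unit_measure g" by (rule square_integrable_imp_integrable[OF gs])
  have ru: "AE x in unit_measure. u x = rep_L2 f x"
    using u(1) by (simp add: C1_representative_def ae_eq_def)
  let ?U = "\<lambda>x. \<Sum>i\<in>UNIV. of_real (r $ i) * (u x $ i * cnj (g x $ i))"
  have bc: "u 0 $ i = 0 \<and> u 1 $ i = 0 \<or> u' 0 $ i = 0 \<and> u' 1 $ i = 0" for i :: 2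
    using u(2-5) exhaust_2[of i] by auto
  note parts = LINT_deriv2_mult_cnj[OF u(1) gi bspec[OF u(6), folded g_def] bc]
  have Ui: "integrable unit_measure ?U"
    using parts(2) by auto
  define V where "V x = Re (cis \<omega> * z * ?U x)" for x
  have Vi: "integrable unit_measure V"
    unfolding V_def[abs_def] by (intro integrable_Re integrable_mult_right Ui)
  define P where "P = (\<Sum>i\<in>UNIV. r $ i * (LINT x|unit_measure. (cmod (u' x $ i))\<^sup>2))"
  have P: "P \<ge> 0"
    unfolding P_def using r by (intro sum_nonneg mult_nonneg_nonneg) (auto simp: less_imp_le)
  have LU: "(LINT x|unit_measure. ?U x) = - of_real P"
    using parts by (simp add: P_def sum_negf)
  have "AE x in unit_measure. \<kappa>\<^sup>2 * (norm (g x))\<^sup>2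
      \<le> R\<^sup>2 * (norm (h x))\<^sup>2 - 2 * \<kappa> * V x"
    using AE_rep_shifted_AD[of A z f] ru
  proof eventually_elim
    case (elim x)
    let ?H = "\<Sum>i\<in>UNIV. of_real (r $ i) * (h x $ i * cnj (g x $ i))"
    have Ag: "A *v g x = - h x - z *s u x"
      using elim by (simp add: g_def h_def)
    have form: "weighted_form r A (g x) (g x) = - ?H - z * ?U x"
      unfolding weighted_form_def Ag
      by (simp add: sum_distrib_left sum_negf[symmetric] sum_subtractf[symmetric] algebra_simps)
    have "cmod ?H \<le> (\<Sum>i\<in>UNIV. r $ i * (norm (h x) * norm (g x)))"
    proof (rule sum_norm_le)
      fix i :: 2
      have "cmod (h x $ i) * cmod (g x $ i) \<le> norm (h x) * norm (g x)"
        by (intro mult_mono Finite_Cartesian_Product.norm_nth_le) auto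
      then show "cmod (of_real (r $ i) * (h x $ i * cnj (g x $ i))) \<le> r $ i * (norm (h x) * norm (g x))"
        using r[of i] by (simp add: norm_mult)
    qed
    then have H: "cmod ?H \<le> R * (norm (h x) * norm (g x))"
      by (simp add: R_def sum_distrib_right)
    have "\<kappa> * (norm (g x))\<^sup>2 \<le> Re (cis \<omega> * (- ?H)) - V x"
      using coercive[of "g x"] unfolding form V_def by (simp add: algebra_simps)
    also have "Re (cis \<omega> * (- ?H)) \<le> cmod (cis \<omega> * (- ?H))" by (rule complex_Re_le_cmod)
    also have "cmod (cis \<omega> * (- ?H)) = cmod ?H" by (simp add: norm_mult)
    finally have "\<kappa> * (norm (g x))\<^sup>2 \<le> R * norm (h x) * norm (g x) - V x"
      using H by (simp add: mult.assoc)
    then have "2 * \<kappa> * (\<kappa> * (norm (g x))\<^sup>2)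
        \<le> 2 * \<kappa> * (R * norm (h x) * norm (g x) - V x)"
      using \<kappa> by (intro mult_left_mono) auto
    moreover have "0 \<le> (R * norm (h x) - \<kappa> * norm (g x))\<^sup>2" by simp
    ultimately show ?case
      by (simp add: power2_eq_square algebra_simps)
  qed
  then have "(LINT x|unit_measure. \<kappa>\<^sup>2 * (norm (g x))\<^sup>2)
      \<le> (LINT x|unit_measure. R\<^sup>2 * (norm (h x))\<^sup>2 - 2 * \<kappa> * V x)"
    by (rule integral_mono_AE[rotated 2]) (use gs hs Vi in \<open>auto simp: square_integrable_def\<close>)
  also have "\<dots> = R\<^sup>2 * (norm (shifted_AD A z f))\<^sup>2 - 2 * \<kappa> * (LINT x|unit_measure. V x)"
    using hs Vi by (simp add: square_integrable_def power2_norm_L2 h_def)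
  also have "(LINT x|unit_measure. V x) = Re (cis \<omega> * z * (LINT x|unit_measure. ?U x))"
    unfolding V_def using Ui
    by (simp only: integral_Re integrable_mult_right integral_mult_right_zero)
  also have "\<dots> = - (Re (cis \<omega> * z) * P)"
    unfolding LU by simp
  finally have "\<kappa>\<^sup>2 * (norm (gen_deriv2 f))\<^sup>2
      \<le> R\<^sup>2 * (norm (shifted_AD A z f))\<^sup>2 + 2 * \<kappa> * (Re (cis \<omega> * z) * P)"
    by (simp add: power2_norm_L2 g_def)
  moreover have "2 * \<kappa> * (Re (cis \<omega> * z) * P) \<le> 0"
    using \<kappa> z P by (intro mult_nonneg_nonpos mult_nonpos_nonneg) auto
  ultimately have "\<kappa>\<^sup>2 * (norm (gen_deriv2 f))\<^sup>2 \<le> R\<^sup>2 * (norm (shifted_AD A z f))\<^sup>2"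
    by linarith
  then have "(\<kappa> * norm (gen_deriv2 f))\<^sup>2 \<le> (R * norm (shifted_AD A z f))\<^sup>2"
    by (simp add: power_mult_distrib)
  then have "\<kappa> * norm (gen_deriv2 f) \<le> R * norm (shifted_AD A z f)"
    by (rule power2_le_imp_le) (use R in simp)
  then show ?thesis
    using \<kappa> by (simp add: R_def field_simps)
qed

lemma norm_shifted_AD_ge:
  assumes r: "\<And>i. 0 < r $ i" and \<kappa>: "\<kappa> > 0"
    and coercive: "\<And>y. \<kappa> * (norm y)\<^sup>2 \<le> Re (cis \<omega> * weighted_form r A y y)"
    and z: "Re (cis \<omega> * z) \<le> 0"
    and f: "f \<in> dom_D"
  shows "cmod z * norm f \<le> (1 + onorm ((*v) A) * ((\<Sum>i\<in>UNIV. r $ i) / \<kappa>)) * norm (shifted_AD A z f)"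
proof -
  have "z *\<^sub>C f = - shifted_AD A z f - matrix_L2 A (gen_deriv2 f)"
    by (simp add: shifted_AD_def op_AD_def)
  then have "cmod z * norm f \<le> norm (shifted_AD A z f) + norm (matrix_L2 A (gen_deriv2 f))"
    using norm_triangle_ineq4[of "- shifted_AD A z f" "matrix_L2 A (gen_deriv2 f)"]
    by (simp flip: norm_scaleC_L2)
  also have "norm (matrix_L2 A (gen_deriv2 f)) \<le> onorm ((*v) A) * norm (gen_deriv2 f)"
    by (rule norm_matrix_L2)
  also have "\<dots> \<le> onorm ((*v) A) * ((\<Sum>i\<in>UNIV. r $ i) / \<kappa> * norm (shifted_AD A z f))"
    by (intro mult_left_mono norm_gen_deriv2_le[OF r \<kappa> coercive z f]
        onorm_pos_le[OF bounded_linear_matrix_vector_complex])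
  finally show ?thesis by (simp add: algebra_simps)
qed

section \<open>Solvability\<close>

definition ode_solution :: "complex^2^2 \<Rightarrow> (real \<Rightarrow> complex^2) \<Rightarrow> (real \<Rightarrow> complex^2) \<Rightarrow> (real \<Rightarrow> complex^2) \<Rightarrow> bool"
  where "ode_solution M q w w' \<longleftrightarrow>
    (\<forall>x\<in>{0..1}. (w has_vector_derivative w' x) (at x within {0..1})) \<and>
    continuous_on {0..1} w' \<and>
    (\<forall>x\<in>{0..1}. w' x = w' 0 + integral {0..x} (\<lambda>t. q t + M *v w t))"

lemma ode_solutionD:
  assumes "ode_solution M q w w'"
  shows "x \<in> {0..1} \<Longrightarrow> (w has_vector_derivative w' x) (at x within {0..1})"
    "continuous_on {0..1} w'" "continuous_on {0..1} w"
    "x \<in> {0..1} \<Longrightarrow> w' x = w' 0 + integral {0..x} (\<lambda>t. q t + M *v w t)"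
  using assms continuous_on_vector_derivative[of "{0..1}" w w'] unfolding ode_solution_def by blast+

lemma continuous_on_matrix_vector: "continuous_on S f \<Longrightarrow> continuous_on S (\<lambda>x. (M :: complex^2^2) *v f x)"
  by (rule bounded_linear.continuous_on[OF bounded_linear_matrix_vector_complex])

lemma square_integrable_ode:
  assumes "ode_solution M q w w'" "square_integrable q"
  shows "square_integrable (\<lambda>t. q t + M *v w t)"
  by (intro square_integrable_add assms(2) square_integrable_matrix
      square_integrable_continuous[OF ode_solutionD(3)[OF assms(1)]])

lemma integrable_on_ode:
  assumes "ode_solution M q w w'" "square_integrable q" "x \<in> {0..1}"
  shows "(\<lambda>t. q t + M *v w t) integrable_on {0..x}"
  using LINT_unit_measure(3)[OF square_integrable_imp_integrable[OF square_integrable_ode[OF assms(1,2)]]]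
  by (rule integrable_on_subinterval) (use assms(3) in auto)

lemma ode_solution_exists:
  fixes M :: "complex^2^2"
  assumes q: "square_integrable q"
  obtains w w' where "ode_solution M q w w'" "w 0 = a" "w' 0 = b"
proof -
  define L where "L = (\<lambda>v :: (complex^2) \<times> (complex^2). (snd v, M *v fst v))"
  define p where "p = (\<lambda>x. (a, b + integral {0..x} q))"
  have L: "bounded_linear L"
    unfolding L_def
    by (intro bounded_linear_Pair bounded_linear_snd
        bounded_linear_compose[OF bounded_linear_matrix_vector_complex bounded_linear_fst])
  have qi: "integrable unit_measure q"
    by (rule square_integrable_imp_integrable[OF q])
  have p: "continuous_on {0..1} p"
    unfolding p_def by (intro continuous_on_Pair continuous_on_const continuous_on_indefinite_integral[OF qi])
  obtain W where W: "continuous_on {0..1} W" "\<And>x. x \<in> {0..1} \<Longrightarrow> W x = p x + integral {0..x} (\<lambda>t. L (W t))"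
    using volterra_solution[OF L p] by blast
  define w w' where "w = (\<lambda>x. fst (W x))" and "w' = (\<lambda>x. snd (W x))"
  have wc: "continuous_on {0..1} w" "continuous_on {0..1} w'"
    unfolding w_def w'_def using W(1) by (auto intro: continuous_on_fst continuous_on_snd)
  have eq: "w x = a + integral {0..x} w'" "w' x = b + integral {0..x} q + integral {0..x} (\<lambda>t. M *v w t)"
    if x: "x \<in> {0..1}" for x
  proof -
    have "continuous_on {0..x} (\<lambda>t. L (W t))"
      by (rule bounded_linear.continuous_on[OF L continuous_on_subset[OF W(1)]]) (use x in auto)
    then have i: "(\<lambda>t. L (W t)) integrable_on {0..x}"
      by (rule integrable_continuous_real)
    show "w x = a + integral {0..x} w'"
      using integral_linear[OF i bounded_linear_fst] arg_cong[OF W(2)[OF x], of fst]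
      by (simp add: w_def w'_def L_def p_def o_def)
    show "w' x = b + integral {0..x} q + integral {0..x} (\<lambda>t. M *v w t)"
      using integral_linear[OF i bounded_linear_snd] arg_cong[OF W(2)[OF x], of snd]
      by (simp add: w_def w'_def L_def p_def o_def)
  qed
  have w0: "w 0 = a" "w' 0 = b"
    using eq[of 0] by simp_all
  have "ode_solution M q w w'"
    unfolding ode_solution_def
  proof (intro conjI ballI)
    fix x :: real assume x: "x \<in> {0..1}"
    have "((\<lambda>x. a + integral {0..x} w') has_vector_derivative 0 + w' x) (at x within {0..1})"
      by (intro has_vector_derivative_add has_vector_derivative_const integral_has_vector_derivative wc x)
    then show "(w has_vector_derivative w' x) (at x within {0..1})"
      by (intro has_vector_derivative_transform[OF x eq(1)]) simp_all
    have "(\<lambda>t. M *v w t) integrable_on {0..x}"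
      by (rule integrable_continuous_real, rule continuous_on_matrix_vector[OF continuous_on_subset[OF wc(1)]]) (use x in auto)
    moreover have "q integrable_on {0..x}"
      using LINT_unit_measure(3)[OF qi] by (rule integrable_on_subinterval) (use x in auto)
    ultimately have "integral {0..x} (\<lambda>t. q t + M *v w t) = integral {0..x} q + integral {0..x} (\<lambda>t. M *v w t)"
      by (intro Henstock_Kurzweil_Integration.integral_add)
    then show "w' x = w' 0 + integral {0..x} (\<lambda>t. q t + M *v w t)"
      using eq(2)[OF x] w0 by (simp add: add.assoc)
  qed (rule wc)
  then show thesis using w0 by (rule that)
qed

lemma ode_solution_add:
  assumes 1: "ode_solution M q1 w1 w1'" "square_integrable q1"
    and 2: "ode_solution M q2 w2 w2'" "square_integrable q2"
  shows "ode_solution M (\<lambda>x. q1 x + q2 x) (\<lambda>x. w1 x + w2 x) (\<lambda>x. w1' x + w2' x)"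
  unfolding ode_solution_def
proof (intro conjI ballI)
  fix x :: real assume x: "x \<in> {0..1}"
  show "((\<lambda>x. w1 x + w2 x) has_vector_derivative w1' x + w2' x) (at x within {0..1})"
    by (intro has_vector_derivative_add ode_solutionD(1)[OF 1(1)] ode_solutionD(1)[OF 2(1)] x)
  have "integral {0..x} (\<lambda>t. q1 t + q2 t + M *v (w1 t + w2 t))
      = integral {0..x} (\<lambda>t. (q1 t + M *v w1 t) + (q2 t + M *v w2 t))"
    by (simp add: matrix_vector_right_distrib add_ac)
  also have "\<dots> = integral {0..x} (\<lambda>t. q1 t + M *v w1 t) + integral {0..x} (\<lambda>t. q2 t + M *v w2 t)"
    by (intro Henstock_Kurzweil_Integration.integral_add integrable_on_ode[OF 1 x] integrable_on_ode[OF 2 x])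
  moreover have "w1' x = w1' 0 + integral {0..x} (\<lambda>t. q1 t + M *v w1 t)"
    "w2' x = w2' 0 + integral {0..x} (\<lambda>t. q2 t + M *v w2 t)"
    by (rule ode_solutionD(4)[OF 1(1) x] ode_solutionD(4)[OF 2(1) x])+
  ultimately show "w1' x + w2' x = w1' 0 + w2' 0 + integral {0..x} (\<lambda>t. q1 t + q2 t + M *v (w1 t + w2 t))"
    by (simp only: add_ac)
next
  show "continuous_on {0..1} (\<lambda>x. w1' x + w2' x)"
    by (intro continuous_on_add ode_solutionD(2)[OF 1(1)] ode_solutionD(2)[OF 2(1)])
qed

lemma ode_solution_scaleC:
  assumes 1: "ode_solution M q w w'" "square_integrable q"
  shows "ode_solution M (\<lambda>x. c *s q x) (\<lambda>x. c *s w x) (\<lambda>x. c *s w' x)"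
  unfolding ode_solution_def
proof (intro conjI ballI)
  note bl = bounded_linear_vector_scalar_complex
  fix x :: real assume x: "x \<in> {0..1}"
  show "((\<lambda>x. c *s w x) has_vector_derivative c *s w' x) (at x within {0..1})"
    by (rule bounded_linear.has_vector_derivative[OF bl ode_solutionD(1)[OF 1(1) x]])
  have "integral {0..x} (\<lambda>t. c *s q t + M *v (c *s w t)) = integral {0..x} (\<lambda>t. c *s (q t + M *v w t))"
    by (simp add: matrix_vector_mult_scaleC vector_add_ldistrib)
  also have "\<dots> = c *s integral {0..x} (\<lambda>t. q t + M *v w t)"
    using integral_linear[OF integrable_on_ode[OF 1 x] bl, of c] by (simp add: o_def)
  also have "c *s w' 0 + \<dots> = c *s w' x"
    by (subst ode_solutionD(4)[OF 1(1) x]) (rule vector_add_ldistrib[symmetric])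
  finally show "c *s w' x = c *s w' 0 + integral {0..x} (\<lambda>t. c *s q t + M *v (c *s w t))"
    by simp
next
  show "continuous_on {0..1} (\<lambda>x. c *s w' x)"
    by (rule bounded_linear.continuous_on[OF bounded_linear_vector_scalar_complex ode_solutionD(2)[OF 1(1)]])
qed

lemma ode_solution_dom_D:
  assumes A: "invertible A" and M: "M = (\<chi> i j. - z * matrix_inv A $ i $ j)"
    and q: "square_integrable q" and w: "ode_solution M q w w'"
    and bc: "w 0 $ 1 = 0" "w 1 $ 1 = 0" "w' 0 $ 2 = 0" "w' 1 $ 2 = 0"
  shows "abs_L2 w \<in> dom_D" "shifted_AD A z (abs_L2 w) = abs_L2 (\<lambda>x. - (A *v q x))"
proof -
  let ?g = "\<lambda>t. q t + M *v w t"
  have gs: "square_integrable ?g" by (rule square_integrable_ode[OF w q])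
  have ws: "square_integrable w" by (rule square_integrable_continuous[OF ode_solutionD(3)[OF w]])
  have C1: "C1_representative (abs_L2 w) w w'"
    using w ws unfolding C1_representative_def ae_eq_rep_L2_iff ode_solution_def by blast
  have eq: "w' x = w' 0 + integral {0..x} (rep_L2 (abs_L2 ?g))" if "x \<in> {0..1}" for x
    unfolding integral_rep_L2_cong[OF gs AE_rep_abs_L2[OF gs] that]
    by (rule ode_solutionD(4)[OF w that])
  show "abs_L2 w \<in> dom_D"
    by (rule dom_DI(1)[OF C1 bc eq])
  have gd: "gen_deriv2 (abs_L2 w) = abs_L2 ?g"
    by (rule dom_DI(2)[OF C1 bc eq])
  have AM: "A *v (M *v v) = - (z *s v)" for v
  proof -
    have Mv: "M *v v = (- z) *s (matrix_inv A *v v)"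
      unfolding M by (simp add: vec_eq_iff matrix_vector_mult_def sum_distrib_left sum_negf mult_ac)
    have "A *v (M *v v) = (- z) *s v"
      unfolding Mv matrix_vector_mult_scaleC matrix_vector_mul_assoc matrix_inv_mult(2)[OF A] by simp
    then show ?thesis by simp
  qed
  show "shifted_AD A z (abs_L2 w) = abs_L2 (\<lambda>x. - (A *v q x))"
  proof (rule L2_eqI)
    show "AE x in unit_measure. rep_L2 (shifted_AD A z (abs_L2 w)) x = rep_L2 (abs_L2 (\<lambda>x. - (A *v q x))) x"
      using AE_rep_shifted_AD[of A z "abs_L2 w"] AE_rep_abs_L2[OF ws] AE_rep_abs_L2[OF gs]
        AE_rep_abs_L2[OF square_integrable_minus[OF square_integrable_matrix[OF q, of A]]]
      unfolding gd
      by eventually_elim (simp add: matrix_vector_right_distrib AM)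
  qed
qed

lemma abs_L2_eq_0_continuous:
  assumes w: "continuous_on {0..1} w" and 0: "abs_L2 w = 0" and x: "x \<in> {0..1}"
  shows "w x = 0"
proof -
  have ws: "square_integrable w" by (rule square_integrable_continuous[OF w])
  have c: "continuous_on {0..1} (\<lambda>x. (norm (w x))\<^sup>2)" using w by (intro continuous_intros)
  have "norm (abs_L2 w) = sqrt (LINT x|unit_measure. (norm (w x))\<^sup>2)"
    using ws by (intro norm_L2.abs_eq) (simp add: ae_eq_def)
  then have "(LINT x|unit_measure. (norm (w x))\<^sup>2) = 0" using 0 by simp
  then have "integral {0..1} (\<lambda>x. (norm (w x))\<^sup>2) = 0"
    using LINT_unit_measure(1)[OF integrable_unit_measure_continuous[OF c]] by simp
  then have "\<forall>x\<in>{0..1}. (norm (w x))\<^sup>2 = 0"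
    by (subst (asm) integral_eq_0_iff[OF c]) auto
  then show ?thesis using x by simp
qed

text \<open>Shooting: injectivity of \<open>A D - z\<close> makes the \<open>2 \<times> 2\<close> system for the two free initial values regular.\<close>

lemma shifted_AD_surj:
  assumes A: "invertible A"
    and inj: "\<And>f. f \<in> dom_D \<Longrightarrow> shifted_AD A z f = 0 \<Longrightarrow> f = 0"
  obtains f where "f \<in> dom_D" "shifted_AD A z f = h"
proof -
  define M where "M = (\<chi> i j. - z * matrix_inv A $ i $ j)"
  define q where "q = (\<lambda>x. - (matrix_inv A *v rep_L2 h x))"
  have q: "square_integrable q"
    unfolding q_def by (intro square_integrable_minus square_integrable_matrix square_integrable_rep_L2)
  have Aq: "abs_L2 (\<lambda>x. - (A *v q x)) = h"
    using linear_neg[OF bounded_linear.linear[OF bounded_linear_matrix_vector_complex[of A]]]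
    by (simp add: q_def matrix_vector_mul_assoc matrix_inv_mult(2)[OF A] abs_rep_L2)
  note sq0 = square_integrable_zero
  obtain w0 w0' where w0: "ode_solution M q w0 w0'" "w0 0 = 0" "w0' 0 = 0"
    by (rule ode_solution_exists[OF q])
  obtain w1 w1' where w1: "ode_solution M (\<lambda>x. 0) w1 w1'" "w1 0 = 0" "w1' 0 = axis 1 1"
    by (rule ode_solution_exists[OF sq0])
  obtain w2 w2' where w2: "ode_solution M (\<lambda>x. 0) w2 w2'" "w2 0 = axis 2 1" "w2' 0 = 0"
    by (rule ode_solution_exists[OF sq0])
  define v v' where "v c = (\<lambda>x. c $ 1 *s w1 x + c $ 2 *s w2 x)"
    and "v' c = (\<lambda>x. c $ 1 *s w1' x + c $ 2 *s w2' x)" for c :: "complex^2"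
  have v: "ode_solution M (\<lambda>x. 0) (v c) (v' c)" for c
    using ode_solution_add[OF ode_solution_scaleC[OF w1(1) sq0] square_integrable_scaleC[OF sq0]
        ode_solution_scaleC[OF w2(1) sq0] square_integrable_scaleC[OF sq0], of "c $ 1" "c $ 2"]
    by (simp add: v_def v'_def)
  have v0: "v c 0 = c $ 2 *s axis 2 1" "v' c 0 = c $ 1 *s axis 1 1" for c
    by (simp_all add: v_def v'_def w1 w2)
  define N :: "complex^2^2" where
    "N = vector [vector [w1 1 $ 1, w2 1 $ 1], vector [w1' 1 $ 2, w2' 1 $ 2]]"
  have N: "(N *v c) $ 1 = v c 1 $ 1" "(N *v c) $ 2 = v' c 1 $ 2" for c
    by (simp_all add: N_def matrix_vector_mult_def sum_2 v_def v'_def mult.commute)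
  have N_inj: "c = 0" if "N *v c = 0" for c
  proof -
    have bc: "v c 0 $ 1 = 0" "v c 1 $ 1 = 0" "v' c 0 $ 2 = 0" "v' c 1 $ 2 = 0"
      using N[of c] that v0[of c] by (simp_all add: axis_def)
    note dom = ode_solution_dom_D[OF A M_def sq0 v bc]
    have "shifted_AD A z (abs_L2 (v c)) = 0"
      unfolding dom(2) by (simp add: zero_L2_def)
    then have "abs_L2 (v c) = 0" by (rule inj[OF dom(1)])
    then have vz: "v c x = 0" if "x \<in> {0..1}" for x
      using abs_L2_eq_0_continuous[OF ode_solutionD(3)[OF v]] that by blast
    have "((\<lambda>x. 0) has_vector_derivative v' c 0) (at 0 within {0..1})"
      by (rule has_vector_derivative_transform[OF _ _ ode_solutionD(1)[OF v]]) (simp_all add: vz)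
    moreover have "((\<lambda>x. 0) has_vector_derivative (0 :: complex^2)) (at 0 within {0..1})"
      by simp
    ultimately have "v' c 0 = 0"
      by (intro vector_derivative_unique_within_closed_interval[of 0 1 0 "\<lambda>x. 0"]) auto
    then have "c $ 1 = 0"
      unfolding v0 by (auto simp: vec_eq_iff axis_def split: if_splits)
    moreover have "c $ 2 = 0"
      using vz[of 0] unfolding v0 by (auto simp: vec_eq_iff axis_def split: if_splits)
    ultimately show ?thesis
      by (simp add: vec_eq_iff forall_2)
  qed
  have lin: "linear ((*v) N)"
    by (rule bounded_linear.linear[OF bounded_linear_matrix_vector_complex])
  have "inj ((*v) N)"
    using N_inj linear_injective_0[OF lin] by blast
  then have "surj ((*v) N)"
    using linear_injective_imp_surjective[OF lin] by simp
  then obtain c where "- vector [w0 1 $ 1, w0' 1 $ 2] = N *v c"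
    by (rule surjE)
  note c = this[symmetric]
  let ?w = "\<lambda>x. w0 x + v c x" and ?w' = "\<lambda>x. w0' x + v' c x"
  have sol: "ode_solution M q ?w ?w'"
    using ode_solution_add[OF w0(1) q v sq0, of c] by simp
  have "?w 0 $ 1 = 0" "?w 1 $ 1 = 0" "?w' 0 $ 2 = 0" "?w' 1 $ 2 = 0"
    using N[of c, symmetric] v0[of c] by (simp_all add: c w0 axis_def vector_def)
  from ode_solution_dom_D[OF A M_def q sol this] show thesis
    unfolding Aq by (rule that)
qed

lemma resolvent_bound:
  assumes A: "invertible A" and r: "\<And>i. 0 < r $ i" and \<kappa>: "\<kappa> > 0"
    and coercive: "\<And>y. \<kappa> * (norm y)\<^sup>2 \<le> Re (cis \<omega> * weighted_form r A y y)"
    and z: "Re (cis \<omega> * z) \<le> 0" "z \<noteq> 0"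
  shows "z \<notin> spectrum dom_D (op_AD A)"
    "onorm (resolvent dom_D (op_AD A) z) \<le> (1 + onorm ((*v) A) * ((\<Sum>i\<in>UNIV. r $ i) / \<kappa>)) / cmod z"
proof -
  define K where "K = 1 + onorm ((*v) A) * ((\<Sum>i\<in>UNIV. r $ i) / \<kappa>)"
  have est: "norm f \<le> norm (shifted_AD A z f) * (K / cmod z)" if "f \<in> dom_D" for f
    using norm_shifted_AD_ge[OF r \<kappa> coercive z(1) that] z(2)
    by (simp add: K_def pos_le_divide_eq mult.commute)
  have inj0: "f = 0" if "f \<in> dom_D" "shifted_AD A z f = 0" for f
    using est[OF that(1)] that(2) by simp
  have "inj_on (shifted_AD A z) dom_D"
  proof (rule inj_onI)
    fix f g assume fg: "f \<in> dom_D" "g \<in> dom_D" "shifted_AD A z f = shifted_AD A z g"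
    note g' = dom_D_scaleR(1)[OF fg(2), of "- 1"]
    have "shifted_AD A z (f + (- 1) *\<^sub>R g) = 0"
      using shifted_AD_add[OF fg(1) g', of A z] shifted_AD_scaleR[OF fg(2), of A z "- 1"] fg(3) by simp
    then have "f + (- 1) *\<^sub>R g = 0" by (rule inj0[OF dom_D_add(1)[OF fg(1) g']])
    then show "f = g" by simp
  qed
  moreover have "h \<in> shifted_AD A z ` dom_D" for h
    using shifted_AD_surj[OF A inj0, of z h] by blast
  ultimately have bij: "bij_betw (shifted_AD A z) dom_D UNIV"
    unfolding bij_betw_def by blast
  define S where "S = inv_into dom_D (shifted_AD A z)"
  have res: "resolvent dom_D (op_AD A) z = S"
    unfolding resolvent_def S_def shifted_AD_def[abs_def] ..
  have S: "S h \<in> dom_D" "shifted_AD A z (S h) = h" for h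
    using bij unfolding S_def bij_betw_def by (auto intro: inv_into_into f_inv_into_f)
  have S_eq: "S (shifted_AD A z f) = f" if "f \<in> dom_D" for f
    using bij that unfolding S_def bij_betw_def by (simp add: inv_into_f_f)
  have bound: "norm (S h) \<le> norm h * (K / cmod z)" for h
    using est[OF S(1)[of h]] by (simp add: S(2))
  have bl: "bounded_linear S"
  proof (rule bounded_linear_intro[OF _ _ bound])
    show "S (g + h) = S g + S h" for g h
      using S_eq[OF dom_D_add(1)[OF S(1)[of g] S(1)[of h]]] shifted_AD_add[OF S(1)[of g] S(1)[of h], of A z]
      by (simp add: S(2))
    show "S (c *\<^sub>R h) = c *\<^sub>R S h" for c h
      using S_eq[OF dom_D_scaleR(1)[OF S(1)[of h], of c]] shifted_AD_scaleR[OF S(1)[of h], of A z c]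
      by (simp add: S(2))
  qed
  show "z \<notin> spectrum dom_D (op_AD A)"
    using bij bl unfolding res[symmetric] shifted_AD_def[abs_def] by (simp add: spectrum_def)
  have "0 \<le> K"
    unfolding K_def using r \<kappa>
    by (intro add_nonneg_nonneg mult_nonneg_nonneg divide_nonneg_pos sum_nonneg
        onorm_pos_le[OF bounded_linear_matrix_vector_complex]) (auto simp: less_imp_le)
  then show "onorm (resolvent dom_D (op_AD A) z) \<le> K / cmod z"
    unfolding res by (intro onorm_bound) (simp, subst mult.commute, rule bound)
qed

theorem theorem10:
  fixes A :: "complex^2^2" and \<alpha> \<beta> :: real
  assumes "invertible A"
    and "\<alpha> \<le> \<beta>" and "\<beta> - \<alpha> < pi"
    and "\<exists>B :: complex^2^2. invertible B \<and> diagonal B \<and>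
           Num (matrix_inv B ** A ** B) \<subseteq> sector \<alpha> \<beta>"
  shows "spectrum dom_D (op_AD A) \<subseteq> sector \<alpha> \<beta> \<and>
    (\<exists>\<epsilon>\<^sub>0>0. \<forall>\<epsilon>. 0 < \<epsilon> \<and> \<epsilon> < \<epsilon>\<^sub>0 \<longrightarrow>
      (\<exists>k>0. \<forall>z. z \<notin> sector (\<alpha> - \<epsilon>) (\<beta> + \<epsilon>) \<longrightarrow>
        onorm (resolvent dom_D (op_AD A) z) \<le> k / cmod z))"
proof -
  obtain B :: "complex^2^2" where B: "invertible B" "diagonal B"
    "Num (matrix_inv B ** A ** B) \<subseteq> sector \<alpha> \<beta>"
    using assms(4) by blast
  obtain r where r: "\<And>i. 0 < r $ i" and form: "\<And>y. weighted_form r A y y \<in> sector \<alpha> \<beta>"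
    using numerical_range_weights[OF B] by blast
  define \<epsilon>\<^sub>0 where "\<epsilon>\<^sub>0 = (pi - (\<beta> - \<alpha>)) / 2"
  have \<epsilon>\<^sub>0: "0 < \<epsilon>\<^sub>0" "\<epsilon>\<^sub>0 \<le> pi / 2" using assms(2,3) by (auto simp: \<epsilon>\<^sub>0_def)
  have "cos ((\<beta> - \<alpha>) / 2) > 0"
    using assms(2,3) by (intro cos_gt_zero_pi) auto
  moreover have "cos ((\<beta> - \<alpha>) / 2) * cmod (weighted_form r A y y)
      \<le> Re (cis (- ((\<alpha> + \<beta>) / 2)) * weighted_form r A y y)" for y
    using assms(2,3) by (intro sector_cone_bound[OF form]) (auto simp: field_simps)
  ultimately obtain c where c: "c > 0" "\<And>y. c * (norm y)\<^sup>2 \<le> cmod (weighted_form r A y y)"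
    using weighted_form_lower_bound[OF r assms(1)] by blast
  define k where "k \<epsilon> = 1 + onorm ((*v) A) * ((\<Sum>i\<in>UNIV. r $ i) / (sin \<epsilon> * c))" for \<epsilon>
  have sin_pos: "sin \<epsilon> > 0" if "0 < \<epsilon>" "\<epsilon> < \<epsilon>\<^sub>0" for \<epsilon>
    using that \<epsilon>\<^sub>0 by (intro sin_gt_zero) auto
  have main: "z \<notin> spectrum dom_D (op_AD A)" "onorm (resolvent dom_D (op_AD A) z) \<le> k \<epsilon> / cmod z"
    if \<epsilon>: "0 < \<epsilon>" "\<epsilon> < \<epsilon>\<^sub>0" and \<zeta>: "is_Arg z \<zeta>" "\<beta> + \<epsilon> \<le> \<zeta>" "\<zeta> \<le> \<alpha> - \<epsilon> + 2 * pi" and "z \<noteq> 0"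
    for \<epsilon> z \<zeta>
  proof -
    obtain \<omega> where \<omega>: "Re (cis \<omega> * z) \<le> 0"
      "\<And>s. s \<in> sector \<alpha> \<beta> \<Longrightarrow> sin \<epsilon> * cmod s \<le> Re (cis \<omega> * s)"
      using separating_direction[OF \<zeta>] \<epsilon> by (metis \<epsilon>\<^sub>0_def less_imp_le)
    have coercive: "sin \<epsilon> * c * (norm y)\<^sup>2 \<le> Re (cis \<omega> * weighted_form r A y y)" for y
    proof -
      have "sin \<epsilon> * (c * (norm y)\<^sup>2) \<le> sin \<epsilon> * cmod (weighted_form r A y y)"
        using c(2) sin_pos[OF \<epsilon>] by (intro mult_left_mono) auto
      also have "\<dots> \<le> Re (cis \<omega> * weighted_form r A y y)" by (rule \<omega>(2)[OF form])
      finally show ?thesis by (simp add: mult.assoc)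
    qed
    have "sin \<epsilon> * c > 0" using sin_pos[OF \<epsilon>] c(1) by simp
    from resolvent_bound[OF assms(1) r this coercive \<omega>(1) \<open>z \<noteq> 0\<close>]
    show "z \<notin> spectrum dom_D (op_AD A)" "onorm (resolvent dom_D (op_AD A) z) \<le> k \<epsilon> / cmod z"
      by (simp_all add: k_def)
  qed
  have "z \<notin> spectrum dom_D (op_AD A)" if z: "z \<notin> sector \<alpha> \<beta>" for z
  proof -
    obtain \<zeta> where \<zeta>: "is_Arg z \<zeta>" "\<beta> < \<zeta>" "\<zeta> < \<alpha> + 2 * pi"
      using not_in_sector_arg[OF z] .
    define \<epsilon> where "\<epsilon> = min (\<epsilon>\<^sub>0 / 2) (min (\<zeta> - \<beta>) (\<alpha> + 2 * pi - \<zeta>))"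
    have "0 < \<epsilon>" "\<epsilon> < \<epsilon>\<^sub>0" "\<beta> + \<epsilon> \<le> \<zeta>" "\<zeta> \<le> \<alpha> - \<epsilon> + 2 * pi"
      using \<zeta> \<epsilon>\<^sub>0 by (auto simp: \<epsilon>_def)
    moreover have "z \<noteq> 0" using z by (auto simp: sector_def)
    ultimately show ?thesis using main(1) \<zeta>(1) by blast
  qed
  moreover have "\<exists>k>0. \<forall>z. z \<notin> sector (\<alpha> - \<epsilon>) (\<beta> + \<epsilon>) \<longrightarrow>
      onorm (resolvent dom_D (op_AD A) z) \<le> k / cmod z" if \<epsilon>: "0 < \<epsilon> \<and> \<epsilon> < \<epsilon>\<^sub>0" for \<epsilon>
  proof (intro exI[of _ "k \<epsilon>"] conjI allI impI)
    have "0 \<le> onorm ((*v) A) * ((\<Sum>i\<in>UNIV. r $ i) / (sin \<epsilon> * c))"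
      using sin_pos \<epsilon> c(1) r
      by (intro mult_nonneg_nonneg divide_nonneg_pos sum_nonneg
          onorm_pos_le[OF bounded_linear_matrix_vector_complex]) (auto simp: less_imp_le)
    then show "k \<epsilon> > 0" by (simp add: k_def)
    fix z assume z: "z \<notin> sector (\<alpha> - \<epsilon>) (\<beta> + \<epsilon>)"
    obtain \<zeta> where "is_Arg z \<zeta>" "\<beta> + \<epsilon> < \<zeta>" "\<zeta> < \<alpha> - \<epsilon> + 2 * pi"
      using not_in_sector_arg[OF z] .
    moreover have "z \<noteq> 0" using z by (auto simp: sector_def)
    ultimately show "onorm (resolvent dom_D (op_AD A) z) \<le> k \<epsilon> / cmod z"
      using main(2)[of \<epsilon> z \<zeta>] \<epsilon> by auto
  qed
  ultimately show ?thesis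
    using \<epsilon>\<^sub>0(1) by (intro conjI exI[of _ \<epsilon>\<^sub>0]) auto
qed

end
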